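(* Let $s\ge2$ and $1\le r\le s-1$. If $R\subset\mathbb N$ is a set of $r$-recurrence for all minimal $(s-1)$-step affine systems, then $R$ is a set of $r$-recurrence for all minimal $s$-step affine systems.
   Context: An affine system is $(\mathbb T^d,T)$ with $T(x)=Mx+\alpha \pmod 1$, where $M$ is a $d\times d$ integer matrix that is unipotent and $\alpha\in\mathbb T^d$; it is $k$-step if $(M-\mathrm{Id})^k=0$ (it is then a $k$-step nilsystem, realized via the group generated by $M$ and the translations of $\mathbb T^d$). Minimal means no proper nonempty closed invariant subset. $R$ is a set of $r$-recurrence for a class of minimal systems if for each system $(X,T)$ in the class and every nonempty open $U\subset X$ there is $n\in R$ with $U\cap T^{-n}U\cap\dots\cap T^{-rn}U\ne\emptyset$. *)

theory Defs
  imports Complex_Main "Jordan_Normal_Form.Matrix"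
begin

definition torus :: "nat \<Rightarrow> real vec set" where
  "torus d = {x. dim_vec x = d \<and> (\<forall>i<d. 0 \<le> x $ i \<and> x $ i < 1)}"

text \<open>Open subsets of T^d for the quotient topology of R^d / Z^d
  (neighbourhoods: coordinatewise distance to the nearest integer translate less than e).\<close>
definition torus_open :: "nat \<Rightarrow> real vec set \<Rightarrow> bool" where
  "torus_open d U \<longleftrightarrow> U \<subseteq> torus d \<and>
     (\<forall>x\<in>U. \<exists>e>0. \<forall>y\<in>torus d.
        (\<forall>i<d. \<exists>k::int. \<bar>x $ i - y $ i - of_int k\<bar> < e) \<longrightarrow> y \<in> U)"

definition torus_closed :: "nat \<Rightarrow> real vec set \<Rightarrow> bool" where
  "torus_closed d A \<longleftrightarrow> A \<subseteq> torus d \<and> torus_open d (torus d - A)"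

definition affine_map :: "nat \<Rightarrow> int mat \<Rightarrow> real vec \<Rightarrow> real vec \<Rightarrow> real vec" where
  "affine_map d M \<alpha> x = vec d (\<lambda>i. frac ((map_mat real_of_int M *\<^sub>v x) $ i + \<alpha> $ i))"

definition affine_system :: "nat \<Rightarrow> nat \<Rightarrow> int mat \<Rightarrow> real vec \<Rightarrow> bool" where
  "affine_system k d M \<alpha> \<longleftrightarrow> M \<in> carrier_mat d d \<and> (M - 1\<^sub>m d) ^\<^sub>m k = 0\<^sub>m d d
     \<and> \<alpha> \<in> torus d"

definition torus_minimal :: "nat \<Rightarrow> (real vec \<Rightarrow> real vec) \<Rightarrow> bool" where
  "torus_minimal d T \<longleftrightarrow> (\<forall>A. A \<noteq> {} \<and> torus_closed d A \<and> T ` A \<subseteq> A \<longrightarrow> A = torus d)"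

definition recurrence_set_affine :: "nat \<Rightarrow> nat \<Rightarrow> nat set \<Rightarrow> bool" where
  "recurrence_set_affine r k R \<longleftrightarrow>
     (\<forall>d M \<alpha>. affine_system k d M \<alpha> \<and> torus_minimal d (affine_map d M \<alpha>) \<longrightarrow>
        (\<forall>U. U \<noteq> {} \<and> torus_open d U \<longrightarrow>
           (\<exists>n\<in>R. \<exists>x\<in>U. \<forall>j\<in>{1..r}. (affine_map d M \<alpha> ^^ (j * n)) x \<in> U)))"

end

theory Submission
  imports Defs "Jordan_Normal_Form.Gauss_Jordan_Elimination" "HOL-Computational_Algebra.Polynomial"
begin

text \<open>Induction on the dimension. Put \<open>N = M - 1\<close> and suppose \<open>N\<^sup>s\<^sup>-\<^sup>1 \<noteq> 0\<close>. Some integer vector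
  \<open>w\<^sub>0\<close> has \<open>N\<^sup>s\<^sup>-\<^sup>1 w\<^sub>0 = g e\<close> with \<open>e\<close> primitive and fixed by \<open>M\<close>, so dividing the torus by the
  circle through \<open>e\<close> gives a minimal affine system of smaller dimension, for which recurrence is
  already known. Lifting a recurrent orbit back, the times \<open>n, 2n, ..., rn\<close> miss the target only by
  multiples \<open>h\<^sub>j e\<close> with \<open>0 \<le> h\<^sub>j < 1\<close>. Moving the starting point by
  \<open>\<Sum>i=1..r. n\<^sup>-\<^sup>i c\<^sub>i N\<^sup>s\<^sup>-\<^sup>1\<^sup>-\<^sup>i w\<^sub>0\<close>, which is \<open>O(1/n)\<close>, changes the \<open>jn\<close>-th iterate by
  \<open>(\<Sum>i=1..r. c\<^sub>i j\<^sup>i / i!) g e + O(1/n)\<close>; as \<open>r \<le> s - 1\<close> these vectors exist, and Lagrange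
  interpolation provides bounded \<open>c\<^sub>i\<close> cancelling all the \<open>h\<^sub>j e\<close>. The return time \<open>n\<close> is large
  because a row fixed by \<open>M\<close> is a nontrivial character along which the system is an irrational
  rotation. All iterates are computed on \<open>\<real>\<^sup>d\<close> and reduced modulo \<open>\<int>\<^sup>d\<close> at the end.\<close>

section \<open>Splitting off the saturation of an integer vector\<close>

text \<open>Euclid's algorithm on the entries of \<open>B\<close>, carried out by row operations.
  The relations say that the block matrices \<open>[S E]\<close> and \<open>[Q; P]\<close> are
  inverse to each other, so \<open>E\<close> is primitive, its span is a direct summand of the
  integer lattice, and \<open>Q\<close> is the projection along \<open>E\<close>.\<close>

lemma integer_column_splitting:
  fixes B :: "int mat"
  assumes "B \<in> carrier_mat d 1" and "B \<noteq> 0\<^sub>m d 1"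
  shows "\<exists>Q S E P g. Q \<in> carrier_mat (d - 1) d \<and> S \<in> carrier_mat d (d - 1) \<and> E \<in> carrier_mat d 1
     \<and> P \<in> carrier_mat 1 d \<and> Q * S = 1\<^sub>m (d - 1)
     \<and> S * Q + E * P = 1\<^sub>m d \<and> B = g \<cdot>\<^sub>m E"
  using assms
proof (induction "\<Sum>i<d. nat \<bar>B $$ (i, 0)\<bar>" arbitrary: B rule: less_induct)
  case less
  note B = less.prems(1)
  obtain p where p: "p < d" "B $$ (p, 0) \<noteq> 0"
    using less.prems by (metis (no_types, lifting) carrier_matD eq_matI index_zero_mat less_one)
  show ?case
  proof (cases "\<exists>q<d. q \<noteq> p \<and> B $$ (q, 0) \<noteq> 0")
    case False
    \<comment> \<open>\<open>\<sigma>\<close> lists the indices other than \<open>p\<close>: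
      \<open>Q\<close> deletes coordinate \<open>p\<close>, and \<open>S\<close> puts a zero back
      there.\<close>
    define \<sigma> where "\<sigma> i = (if i < p then i else Suc i)" for i
    define Q :: "int mat" where "Q = mat (d - 1) d (\<lambda>(i, j). if j = \<sigma> i then 1 else 0)"
    define S :: "int mat" where "S = mat d (d - 1) (\<lambda>(j, i). if j = \<sigma> i then 1 else 0)"
    define E :: "int mat" where "E = mat d 1 (\<lambda>(j, i). if j = p then 1 else 0)"
    define P :: "int mat" where "P = mat 1 d (\<lambda>(i, j). if j = p then 1 else 0)"
    have \<sigma>_lt: "\<sigma> i < d" if "i < d - 1" for i
      using that by (auto simp: \<sigma>_def)
    have \<sigma>_eq: "\<sigma> i = \<sigma> j \<longleftrightarrow> i = j" for i j
      by (auto simp: \<sigma>_def)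
    have \<sigma>_ne: "\<sigma> i \<noteq> p" "p \<noteq> \<sigma> i" for i
      by (auto simp: \<sigma>_def)
    have QS: "Q * S = 1\<^sub>m (d - 1)"
      by (rule eq_matI)
        (auto simp: Q_def S_def scalar_prod_def \<sigma>_eq \<sigma>_lt if_distrib[of "\<lambda>x. x * _"] sum.delta cong: if_cong)
    have SQ: "(S * Q) $$ (i, j) = (if i = j \<and> i \<noteq> p then 1 else 0)" if "i < d" "j < d" for i j
    proof -
      have "(S * Q) $$ (i, j) = (\<Sum>k = 0..<d - 1. (if i = \<sigma> k then 1 else 0) * (if j = \<sigma> k then 1 else 0))"
        using that by (simp add: S_def Q_def scalar_prod_def)
      also have "\<dots> = (\<Sum>k = 0..<d - 1. if i = \<sigma> k then (if i = j then 1 else 0) else 0)"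
        by (intro sum.cong) auto
      also have "\<dots> = (if i = j \<and> i \<noteq> p then 1 else 0)"
      proof (cases "i = p")
        case True
        then show ?thesis using \<sigma>_ne by (auto intro!: sum.neutral)
      next
        case False
        define k where "k = (if i < p then i else i - 1)"
        have k: "i = \<sigma> k" "k < d - 1"
          using False that p by (auto simp: k_def \<sigma>_def)
        show ?thesis
          unfolding k(1) \<sigma>_eq using k(2) \<sigma>_ne by (simp add: sum.delta)
      qed
      finally show ?thesis .
    qed
    have "S * Q + E * P = 1\<^sub>m d"
    proof (rule eq_matI)
      fix i j assume "i < dim_row (1\<^sub>m d :: int mat)" "j < dim_col (1\<^sub>m d :: int mat)"
      then have ij: "i < d" "j < d" by auto
      have "(E * P) $$ (i, j) = (if i = p \<and> j = p then 1 else 0)"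
        using ij by (simp add: E_def P_def scalar_prod_def)
      then show "(S * Q + E * P) $$ (i, j) = 1\<^sub>m d $$ (i, j)"
        using ij SQ[OF ij] by (auto simp: E_def P_def)
    qed (auto simp: S_def Q_def E_def P_def)
    moreover have "B = B $$ (p, 0) \<cdot>\<^sub>m E"
      using B False by (intro eq_matI) (auto simp: E_def)
    moreover have "Q \<in> carrier_mat (d - 1) d" "S \<in> carrier_mat d (d - 1)" "E \<in> carrier_mat d 1"
      "P \<in> carrier_mat 1 d"
      by (auto simp: Q_def S_def E_def P_def)
    ultimately show ?thesis using QS by blast
  next
    case True
    then obtain q where q: "q < d" "q \<noteq> p" "B $$ (q, 0) \<noteq> 0" by blast
    obtain k l where kl: "k < d" "l < d" "k \<noteq> l" "B $$ (k, 0) \<noteq> 0"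
      "\<bar>B $$ (k, 0)\<bar> \<le> \<bar>B $$ (l, 0)\<bar>"
      using p q by (metis linorder_le_cases)
    \<comment> \<open>One step of the Euclidean algorithm decreases the sum of absolute values.\<close>
    define c :: int where "c = - (sgn (B $$ (k, 0)) * sgn (B $$ (l, 0)))"
    have dec: "\<bar>B $$ (l, 0) + c * B $$ (k, 0)\<bar> < \<bar>B $$ (l, 0)\<bar>"
      using kl by (auto simp: c_def sgn_if split: if_splits)
    define F where "F = addrow_mat d c l k"
    define F' where "F' = addrow_mat d (- c) l k"
    have F[simp]: "F \<in> carrier_mat d d" "F' \<in> carrier_mat d d"
      by (auto simp: F_def F'_def)
    have FF: "F * F' = 1\<^sub>m d" "F' * F = 1\<^sub>m d"
      using addrow_mat_inv[of l d k c] addrow_mat_inv[of l d k "- c"] kl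
      by (auto simp: F_def F'_def)
    define B' where "B' = F * B"
    have B': "B' \<in> carrier_mat d 1"
      using mult_carrier_mat[OF F(1) B] by (simp add: B'_def)
    have B'_add: "B' = addrow c l k B"
      unfolding B'_def F_def using addrow_mat[OF B kl(1)] by simp
    have ent: "B' $$ (i, 0) = (if i = l then c * B $$ (k, 0) + B $$ (l, 0) else B $$ (i, 0))" if "i < d" for i
      using that B by (simp add: B'_add)
    have "(\<Sum>i<d. nat \<bar>B' $$ (i, 0)\<bar>) < (\<Sum>i<d. nat \<bar>B $$ (i, 0)\<bar>)"
      by (rule sum_strict_mono_ex1) (use dec kl ent in \<open>auto simp: add.commute\<close>)
    moreover have "B' \<noteq> 0\<^sub>m d 1"
      using ent[of k] kl by auto
    ultimately obtain Q S E P g where IH: "Q \<in> carrier_mat (d - 1) d" "S \<in> carrier_mat d (d - 1)"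
      "E \<in> carrier_mat d 1" "P \<in> carrier_mat 1 d" "Q * S = 1\<^sub>m (d - 1)"
      "S * Q + E * P = 1\<^sub>m d" "B' = g \<cdot>\<^sub>m E"
      using less.hyps[OF _ B'] by blast
    have cancel: "F * (F' * X) = X" "F' * (F * X) = X" if "X \<in> carrier_mat d n" for X n
      using FF assoc_mult_mat[OF F(1) F(2) that] assoc_mult_mat[OF F(2) F(1) that] that by auto
    \<comment> \<open>Change of basis by \<open>F\<close> with inverse \<open>F'\<close>: the
      splitting found for \<open>B' = F * B\<close> is carried back to \<open>B\<close>.\<close>
    have "(Q * F) * (F' * S) = 1\<^sub>m (d - 1)"
      using assoc_mult_mat[OF IH(1) F(1), of "F' * S" "d - 1"] IH cancel[OF IH(2)] F
      by (metis mult_carrier_mat)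
    moreover have "(F' * S) * (Q * F) + (F' * E) * (P * F) = 1\<^sub>m d"
    proof -
      have "(F' * S) * (Q * F) = F' * (S * Q) * F"
        using assoc_mult_mat[OF F(2) IH(2), of "Q * F" d] assoc_mult_mat[OF IH(2) IH(1) F(1)]
          assoc_mult_mat[OF F(2) _ F(1), of "S * Q"] IH F by (metis mult_carrier_mat)
      moreover have "(F' * E) * (P * F) = F' * (E * P) * F"
        using assoc_mult_mat[OF F(2) IH(3), of "P * F" d] assoc_mult_mat[OF IH(3) IH(4) F(1)]
          assoc_mult_mat[OF F(2) _ F(1), of "E * P"] IH F by (metis mult_carrier_mat)
      moreover have "F' * (S * Q) * F + F' * (E * P) * F = F' * (S * Q + E * P) * F"
      proof -
        have c: "S * Q \<in> carrier_mat d d" "E * P \<in> carrier_mat d d"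
          using IH by auto
        show ?thesis
          using mult_add_distrib_mat[OF F(2) c] add_mult_distrib_mat[OF
              mult_carrier_mat[OF F(2) c(1)] mult_carrier_mat[OF F(2) c(2)] F(1)] by metis
      qed
      ultimately show ?thesis using IH(6) FF F by simp
    qed
    moreover have "B = g \<cdot>\<^sub>m (F' * E)"
      using cancel(2)[OF B] IH(7) mult_smult_distrib[OF F(2) IH(3)] by (simp add: B'_def)
    moreover have "Q * F \<in> carrier_mat (d - 1) d" "F' * S \<in> carrier_mat d (d - 1)"
      "F' * E \<in> carrier_mat d 1" "P * F \<in> carrier_mat 1 d"
      by (rule mult_carrier_mat IH F)+
    ultimately show ?thesis by blast
  qed
qed

section \<open>Torus maps and their lifts\<close>

abbreviation rmat :: "int mat \<Rightarrow> real mat" where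
  "rmat \<equiv> map_mat real_of_int"

text \<open>Closeness on the torus for arbitrary representatives in R^d, with one integer per
  coordinate as in \<open>torus_open\<close>. No reduction is built in, so it applies directly to
  lifted orbits.\<close>

definition near_mod1 :: "nat \<Rightarrow> real \<Rightarrow> real vec \<Rightarrow> real vec \<Rightarrow> bool" where
  "near_mod1 d e x y \<longleftrightarrow> (\<forall>i<d. \<exists>k::int. \<bar>x $ i - y $ i - of_int k\<bar> < e)"

definition cong_mod1 :: "nat \<Rightarrow> real vec \<Rightarrow> real vec \<Rightarrow> bool" where
  "cong_mod1 d x y \<longleftrightarrow> (\<forall>i<d. x $ i - y $ i \<in> \<int>)"

definition reduce_mod1 :: "nat \<Rightarrow> real vec \<Rightarrow> real vec" where
  "reduce_mod1 d x = vec d (\<lambda>i. frac (x $ i))"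

text \<open>The torus map without \<open>frac\<close>: an affine map of R^d, whose iterates are
  accessible to linear algebra.\<close>

definition affine_lift :: "int mat \<Rightarrow> real vec \<Rightarrow> real vec \<Rightarrow> real vec" where
  "affine_lift M \<alpha> x = rmat M *\<^sub>v x + \<alpha>"

lemma index_rmat_mult_vec:
  assumes "A \<in> carrier_mat m n" "x \<in> carrier_vec n" "i < m"
  shows "(rmat A *\<^sub>v x) $ i = (\<Sum>j<n. of_int (A $$ (i, j)) * x $ j)"
  using assms by (auto simp: scalar_prod_def lessThan_atLeast0 intro!: sum.cong)

lemma cong_mod1_refl [simp]: "cong_mod1 d x x"
  by (simp add: cong_mod1_def)

lemma cong_mod1_sym: "cong_mod1 d x y \<Longrightarrow> cong_mod1 d y x"
  unfolding cong_mod1_def by (metis Ints_minus minus_diff_eq)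

lemma cong_mod1_rmat:
  assumes "A \<in> carrier_mat m n" "x \<in> carrier_vec n" "y \<in> carrier_vec n" "cong_mod1 n x y"
  shows "cong_mod1 m (rmat A *\<^sub>v x) (rmat A *\<^sub>v y)"
  unfolding cong_mod1_def
proof (intro allI impI)
  fix i assume i: "i < m"
  have "(rmat A *\<^sub>v x) $ i - (rmat A *\<^sub>v y) $ i = (\<Sum>j<n. of_int (A $$ (i, j)) * (x $ j - y $ j))"
    using assms i by (simp only: index_rmat_mult_vec right_diff_distrib sum_subtractf)
  also have "\<dots> \<in> \<int>"
    using assms(4) by (auto simp: cong_mod1_def)
  finally show "(rmat A *\<^sub>v x) $ i - (rmat A *\<^sub>v y) $ i \<in> \<int>" .
qed

lemma cong_mod1_add_right:
  assumes "cong_mod1 d x y" "z \<in> carrier_vec d" "x \<in> carrier_vec d" "y \<in> carrier_vec d"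
  shows "cong_mod1 d (x + z) (y + z)"
  using assms by (auto simp: cong_mod1_def)

lemma near_mod1_refl: "e > 0 \<Longrightarrow> near_mod1 d e x x"
  unfolding near_mod1_def by (auto intro!: exI[of _ 0])

lemma near_mod1_sym:
  assumes "near_mod1 d e x y" shows "near_mod1 d e y x"
  unfolding near_mod1_def
proof (intro allI impI)
  fix i assume "i < d"
  then obtain k :: int where "\<bar>x $ i - y $ i - of_int k\<bar> < e"
    using assms by (auto simp: near_mod1_def)
  then have "\<bar>y $ i - x $ i - of_int (- k)\<bar> < e" by simp
  then show "\<exists>k::int. \<bar>y $ i - x $ i - of_int k\<bar> < e" by blast
qed

lemma near_mod1_triangle:
  assumes "near_mod1 d e x y" "near_mod1 d f y z" shows "near_mod1 d (e + f) x z"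
  unfolding near_mod1_def
proof (intro allI impI)
  fix i assume "i < d"
  then obtain k l :: int where "\<bar>x $ i - y $ i - of_int k\<bar> < e" "\<bar>y $ i - z $ i - of_int l\<bar> < f"
    using assms unfolding near_mod1_def by blast
  then have "\<bar>x $ i - z $ i - of_int (k + l)\<bar> < e + f"
    unfolding of_int_add by linarith
  then show "\<exists>k::int. \<bar>x $ i - z $ i - of_int k\<bar> < e + f" by blast
qed

lemma near_mod1_mono: "near_mod1 d e x y \<Longrightarrow> e \<le> f \<Longrightarrow> near_mod1 d f x y"
  unfolding near_mod1_def by (meson order_less_le_trans)

lemma cong_mod1_imp_near: "cong_mod1 d x y \<Longrightarrow> e > 0 \<Longrightarrow> near_mod1 d e x y"
  unfolding near_mod1_def cong_mod1_def by (metis Ints_cases abs_zero diff_self)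

lemma near_cong_mod1:
  assumes "near_mod1 d e x y" "cong_mod1 d y z" shows "near_mod1 d e x z"
  unfolding near_mod1_def
proof (intro allI impI)
  fix i assume "i < d"
  then obtain k l :: int where "\<bar>x $ i - y $ i - of_int k\<bar> < e" "y $ i - z $ i = of_int l"
    using assms unfolding near_mod1_def cong_mod1_def by (metis Ints_cases)
  then have "\<bar>x $ i - z $ i - of_int (k + l)\<bar> < e"
    unfolding of_int_add by linarith
  then show "\<exists>k::int. \<bar>x $ i - z $ i - of_int k\<bar> < e" by blast
qed

lemma cong_near_mod1: "cong_mod1 d x y \<Longrightarrow> near_mod1 d e y z \<Longrightarrow> near_mod1 d e x z"
  using near_cong_mod1 near_mod1_sym cong_mod1_sym by metis

text \<open>Integer matrices are Lipschitz between tori: they send lattice vectors to lattice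
  vectors, so an integer translate \<open>k\<close> for the pair \<open>x\<close>, \<open>y\<close>
  becomes the translate \<open>A k\<close> for the images.\<close>

lemma near_mod1_rmat:
  assumes A: "A \<in> carrier_mat m n"
  obtains C where "C > 0"
    "\<And>e x y. e > 0 \<Longrightarrow> x \<in> carrier_vec n \<Longrightarrow> y \<in> carrier_vec n \<Longrightarrow> near_mod1 n e x y \<Longrightarrow>
       near_mod1 m (C * e) (rmat A *\<^sub>v x) (rmat A *\<^sub>v y)"
proof
  \<comment> \<open>The summand 1 makes \<open>C\<close> positive and the final estimate strict,
    also when \<open>A\<close> is zero.\<close>
  define C where "C = 1 + (\<Sum>i<m. \<Sum>j<n. \<bar>real_of_int (A $$ (i, j))\<bar>)"
  show "C > 0"
    by (simp add: C_def add_pos_nonneg sum_nonneg)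
  fix e :: real and x y :: "real vec"
  assume *: "e > 0" "x \<in> carrier_vec n" "y \<in> carrier_vec n" "near_mod1 n e x y"
  obtain k :: "nat \<Rightarrow> int" where k: "\<And>j. j < n \<Longrightarrow> \<bar>x $ j - y $ j - of_int (k j)\<bar> < e"
    using *(4) unfolding near_mod1_def by metis
  show "near_mod1 m (C * e) (rmat A *\<^sub>v x) (rmat A *\<^sub>v y)"
    unfolding near_mod1_def
  proof (intro allI impI)
    fix i assume i: "i < m"
    have "(rmat A *\<^sub>v x) $ i - (rmat A *\<^sub>v y) $ i - of_int (\<Sum>j<n. A $$ (i, j) * k j)
        = (\<Sum>j<n. of_int (A $$ (i, j)) * (x $ j - y $ j - of_int (k j)))"
      unfolding index_rmat_mult_vec[OF A *(2) i] index_rmat_mult_vec[OF A *(3) i]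
      by (simp add: right_diff_distrib sum_subtractf)
    also have "\<bar>\<dots>\<bar> \<le> (\<Sum>j<n. \<bar>of_int (A $$ (i, j))\<bar> * e)"
      by (rule order_trans[OF sum_abs sum_mono])
        (auto simp: abs_mult intro: mult_left_mono less_imp_le[OF k])
    also have "\<dots> = (\<Sum>j<n. \<bar>real_of_int (A $$ (i, j))\<bar>) * e"
      by (simp add: sum_distrib_right)
    also have "\<dots> \<le> (C - 1) * e"
      using *(1) i unfolding C_def
      by (intro mult_right_mono) (auto intro!: member_le_sum[of i "{..<m}" "\<lambda>i. \<Sum>j<n. \<bar>real_of_int (A $$ (i, j))\<bar>"] sum_nonneg)
    also have "\<dots> < C * e" using *(1) by simp
    finally show "\<exists>k::int. \<bar>(rmat A *\<^sub>v x) $ i - (rmat A *\<^sub>v y) $ i - of_int k\<bar> < C * e"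
      by blast
  qed
qed

lemma reduce_mod1_carrier [simp]: "reduce_mod1 d x \<in> carrier_vec d"
  by (simp add: reduce_mod1_def)

lemma reduce_mod1_torus [simp]: "reduce_mod1 d x \<in> torus d"
  by (simp add: reduce_mod1_def torus_def frac_lt_1)

lemma torus_carrier: "x \<in> torus d \<Longrightarrow> x \<in> carrier_vec d"
  by (rule carrier_vecI) (simp add: torus_def)

lemma cong_reduce_mod1 [simp]: "cong_mod1 d (reduce_mod1 d x) x" "cong_mod1 d x (reduce_mod1 d x)"
  by (auto simp: cong_mod1_def reduce_mod1_def frac_def)

lemma reduce_mod1_eqI:
  assumes "cong_mod1 d x y" shows "reduce_mod1 d x = reduce_mod1 d y"
proof (rule eq_vecI)
  fix i assume "i < dim_vec (reduce_mod1 d y)"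
  then have i: "i < d" by (simp add: reduce_mod1_def)
  then have "x $ i - y $ i \<in> \<int>" using assms by (simp add: cong_mod1_def)
  then obtain k where "x $ i = y $ i + of_int k"
    by (metis Ints_cases add.commute diff_add_cancel)
  then show "reduce_mod1 d x $ i = reduce_mod1 d y $ i"
    using i by (simp add: reduce_mod1_def frac_def)
qed (simp add: reduce_mod1_def)

lemma reduce_mod1_torus_id: "x \<in> torus d \<Longrightarrow> reduce_mod1 d x = x"
  by (rule eq_vecI) (auto simp: reduce_mod1_def torus_def frac_eq)

lemma affine_lift_carrier [simp]:
  "M \<in> carrier_mat d d \<Longrightarrow> \<alpha> \<in> carrier_vec d \<Longrightarrow> affine_lift M \<alpha> x \<in> carrier_vec d"
  by (intro carrier_vecI) (simp add: affine_lift_def)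

lemma affine_lift_funpow_carrier [simp]:
  assumes "M \<in> carrier_mat d d" "\<alpha> \<in> carrier_vec d" "x \<in> carrier_vec d"
  shows "(affine_lift M \<alpha> ^^ n) x \<in> carrier_vec d"
  using assms by (induction n) auto

lemma affine_map_eq_reduce:
  assumes "M \<in> carrier_mat d d" "\<alpha> \<in> carrier_vec d"
  shows "affine_map d M \<alpha> x = reduce_mod1 d (affine_lift M \<alpha> x)"
  using assms by (intro eq_vecI) (auto simp: affine_map_def reduce_mod1_def affine_lift_def)

lemma affine_lift_cong:
  assumes "M \<in> carrier_mat d d" "\<alpha> \<in> carrier_vec d" "x \<in> carrier_vec d" "y \<in> carrier_vec d"
    and "cong_mod1 d x y"
  shows "cong_mod1 d (affine_lift M \<alpha> x) (affine_lift M \<alpha> y)"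
  unfolding affine_lift_def using assms
  by (intro cong_mod1_add_right cong_mod1_rmat[where n = d]) auto

lemma affine_map_reduce_mod1:
  assumes "M \<in> carrier_mat d d" "\<alpha> \<in> carrier_vec d" "x \<in> carrier_vec d"
  shows "affine_map d M \<alpha> (reduce_mod1 d x) = reduce_mod1 d (affine_lift M \<alpha> x)"
  using assms by (auto simp: affine_map_eq_reduce intro!: reduce_mod1_eqI affine_lift_cong)

text \<open>Reduction mod 1 semiconjugates the lift to the torus map, so it can be postponed to the
  end of an orbit computation.\<close>

lemma affine_map_funpow_reduce_mod1:
  assumes "M \<in> carrier_mat d d" "\<alpha> \<in> carrier_vec d" "x \<in> carrier_vec d"
  shows "(affine_map d M \<alpha> ^^ n) (reduce_mod1 d x) = reduce_mod1 d ((affine_lift M \<alpha> ^^ n) x)"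
  using assms by (induction n) (auto simp: affine_map_reduce_mod1)

section \<open>Open sets and recurrence in terms of lifts\<close>

lemma torus_open_near:
  "torus_open d U \<longleftrightarrow> U \<subseteq> torus d \<and> (\<forall>x\<in>U. \<exists>e>0. \<forall>y\<in>torus d. near_mod1 d e x y \<longrightarrow> y \<in> U)"
  by (simp add: torus_open_def near_mod1_def)

lemma torus_open_near_ball: "torus_open d {y \<in> torus d. near_mod1 d e x y}"
  unfolding torus_open_near
proof (intro conjI ballI)
  fix y assume "y \<in> {y \<in> torus d. near_mod1 d e x y}"
  then obtain k :: "nat \<Rightarrow> int" where k: "\<And>i. i < d \<Longrightarrow> \<bar>x $ i - y $ i - of_int (k i)\<bar> < e"
    unfolding near_mod1_def by auto metis
  \<comment> \<open>The least slack over the finitely many coordinates; the inserted 1 keeps the set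
    nonempty when \<open>d = 0\<close>.\<close>
  define f where "f = Min (insert 1 ((\<lambda>i. e - \<bar>x $ i - y $ i - of_int (k i)\<bar>) ` {..<d}))"
  have f: "f > 0" unfolding f_def using k by (subst Min_gr_iff) auto
  have fi: "\<bar>x $ i - y $ i - of_int (k i)\<bar> + f \<le> e" if "i < d" for i
  proof -
    have "f \<le> e - \<bar>x $ i - y $ i - of_int (k i)\<bar>"
      unfolding f_def using that by (intro Min_le) auto
    then show ?thesis by simp
  qed
  have "near_mod1 d e x z" if z: "near_mod1 d f y z" for z
    unfolding near_mod1_def
  proof (intro allI impI)
    fix i assume i: "i < d"
    then obtain l :: int where "\<bar>y $ i - z $ i - of_int l\<bar> < f"
      using z unfolding near_mod1_def by blast
    then have "\<bar>x $ i - z $ i - of_int (k i + l)\<bar> < e"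
      using fi[OF i] unfolding of_int_add by linarith
    then show "\<exists>k::int. \<bar>x $ i - z $ i - of_int k\<bar> < e" by blast
  qed
  then show "\<exists>f>0. \<forall>z\<in>torus d. near_mod1 d f y z \<longrightarrow> z \<in> {y \<in> torus d. near_mod1 d e x y}"
    using f by blast
qed auto

text \<open>Balls around points suffice in place of open sets, and orbits may be computed in R^d. On
  the lifted side the index \<open>j = 0\<close> records that the starting point itself lies in the
  neighbourhood.\<close>

lemma recurrence_iff_lift:
  assumes M: "M \<in> carrier_mat d d" and \<alpha>: "\<alpha> \<in> carrier_vec d"
  shows "(\<forall>U. U \<noteq> {} \<and> torus_open d U \<longrightarrow>
            (\<exists>n\<in>R. \<exists>x\<in>U. \<forall>j\<in>{1..r}. (affine_map d M \<alpha> ^^ (j * n)) x \<in> U)) \<longleftrightarrow>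
         (\<forall>x0\<in>carrier_vec d. \<forall>e>0. \<exists>n\<in>R. \<exists>x\<in>carrier_vec d. \<forall>j\<le>r.
            near_mod1 d e x0 ((affine_lift M \<alpha> ^^ (j * n)) x))" (is "?L \<longleftrightarrow> ?R")
proof
  assume L: ?L
  show ?R
  proof (intro ballI allI impI)
    fix x0 :: "real vec" and e :: real assume x0: "x0 \<in> carrier_vec d" and e: "e > 0"
    define U where "U = {y \<in> torus d. near_mod1 d e x0 y}"
    have "reduce_mod1 d x0 \<in> U"
      using e by (auto simp: U_def intro!: cong_mod1_imp_near)
    moreover have "torus_open d U"
      unfolding U_def by (rule torus_open_near_ball)
    ultimately have "U \<noteq> {} \<and> torus_open d U" by blast
    then obtain n x where nx: "n \<in> R" "x \<in> U" "\<And>j. j \<in> {1..r} \<Longrightarrow> (affine_map d M \<alpha> ^^ (j * n)) x \<in> U"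
      using spec[OF L, of U] by metis
    have x: "x \<in> carrier_vec d" "reduce_mod1 d x = x"
      using nx(2) by (auto simp: U_def torus_carrier reduce_mod1_torus_id)
    have "near_mod1 d e x0 ((affine_lift M \<alpha> ^^ (j * n)) x)" if "j \<le> r" for j
    proof -
      have "(affine_map d M \<alpha> ^^ (j * n)) x \<in> U"
        using nx that by (cases "j = 0") auto
      then have "near_mod1 d e x0 (reduce_mod1 d ((affine_lift M \<alpha> ^^ (j * n)) x))"
        using affine_map_funpow_reduce_mod1[OF M \<alpha> x(1), of "j * n"] x(2) by (simp add: U_def)
      then show ?thesis by (rule near_cong_mod1) simp
    qed
    then show "\<exists>n\<in>R. \<exists>x\<in>carrier_vec d. \<forall>j\<le>r. near_mod1 d e x0 ((affine_lift M \<alpha> ^^ (j * n)) x)"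
      using nx(1) x(1) by blast
  qed
next
  assume R: ?R
  show ?L
  proof (intro allI impI, elim conjE)
    fix U assume "U \<noteq> {}" and U: "torus_open d U"
    then obtain x0 where x0: "x0 \<in> U" by blast
    then obtain e where e: "e > 0" "\<And>y. y \<in> torus d \<Longrightarrow> near_mod1 d e x0 y \<Longrightarrow> y \<in> U"
      using U unfolding torus_open_near by blast
    have "x0 \<in> carrier_vec d"
      using x0 U torus_carrier unfolding torus_open_near by blast
    then obtain n x where nx: "n \<in> R" "x \<in> carrier_vec d"
      "\<And>j. j \<le> r \<Longrightarrow> near_mod1 d e x0 ((affine_lift M \<alpha> ^^ (j * n)) x)"
      using bspec[OF R, of x0] e(1) by metis
    have *: "(affine_map d M \<alpha> ^^ (j * n)) (reduce_mod1 d x) \<in> U" if "j \<le> r" for j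
      unfolding affine_map_funpow_reduce_mod1[OF M \<alpha> nx(2)]
      by (intro e(2) reduce_mod1_torus near_cong_mod1[OF nx(3)[OF that]] cong_reduce_mod1)
    have "reduce_mod1 d x \<in> U" using *[of 0] by simp
    then show "\<exists>n\<in>R. \<exists>x\<in>U. \<forall>j\<in>{1..r}. (affine_map d M \<alpha> ^^ (j * n)) x \<in> U"
      using * nx(1) by (intro bexI[of _ n] bexI[of _ "reduce_mod1 d x"] ballI) auto
  qed
qed

section \<open>Integer factors and minimality\<close>

lemma rmat_mult_mat_vec:
  assumes "A \<in> carrier_mat m n" "B \<in> carrier_mat n k" "x \<in> carrier_vec k"
  shows "rmat (A * B) *\<^sub>v x = rmat A *\<^sub>v (rmat B *\<^sub>v x)"
  using assms by (simp add: of_int_hom.mat_hom_mult[OF assms(1,2)] assoc_mult_mat_vec[of _ m n _ k])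

lemma rmat_one_mult_vec: "x \<in> carrier_vec d \<Longrightarrow> rmat (1\<^sub>m d) *\<^sub>v x = x"
  by (simp add: of_int_hom.mat_hom_one)

lemma rmat_mult_add_vec:
  assumes "A \<in> carrier_mat m n" "x \<in> carrier_vec n" "y \<in> carrier_vec n"
  shows "rmat A *\<^sub>v (x + y) = rmat A *\<^sub>v x + rmat A *\<^sub>v y"
  using assms by (intro mult_add_distrib_mat_vec[of _ m n]) auto

lemma rmat_mult_vec_carrier [simp]:
  "A \<in> carrier_mat m n \<Longrightarrow> rmat A *\<^sub>v x \<in> carrier_vec m"
  by (intro carrier_vecI) simp

text \<open>\<open>affine_system\<close> asks for a translation vector in the unit cube, which the
  image of \<open>\<alpha>\<close> under an integer matrix may leave; this permits reducing
  it.\<close>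

lemma affine_map_reduce_translation:
  assumes "M \<in> carrier_mat d d" "\<alpha> \<in> carrier_vec d"
  shows "affine_map d M (reduce_mod1 d \<alpha>) = affine_map d M \<alpha>"
proof
  fix x
  have "cong_mod1 d (affine_lift M (reduce_mod1 d \<alpha>) x) (affine_lift M \<alpha> x)"
    using assms by (auto simp: cong_mod1_def affine_lift_def reduce_mod1_def frac_def)
  then show "affine_map d M (reduce_mod1 d \<alpha>) x = affine_map d M \<alpha> x"
    using assms by (simp add: affine_map_eq_reduce reduce_mod1_eqI)
qed

text \<open>The integer matrix \<open>Q\<close> induces a map of tori, \<open>QM\<close> makes it
  intertwine the two affine maps, and \<open>QS\<close> provides the section \<open>S\<close>, hence
  surjectivity.\<close>

locale integer_factor =
  fixes m d :: nat and M M' Q S :: "int mat" and \<alpha> :: "real vec"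
  assumes M: "M \<in> carrier_mat d d" and \<alpha>: "\<alpha> \<in> carrier_vec d" and M': "M' \<in> carrier_mat m m"
    and Q: "Q \<in> carrier_mat m d" and S: "S \<in> carrier_mat d m"
    and QS: "Q * S = 1\<^sub>m m" and QM: "Q * M = M' * Q"
begin

definition "\<beta> = rmat Q *\<^sub>v \<alpha>"

lemma \<beta>: "\<beta> \<in> carrier_vec m"
  using Q by (simp add: \<beta>_def)

lemma affine_lift_factor:
  assumes "x \<in> carrier_vec d"
  shows "rmat Q *\<^sub>v affine_lift M \<alpha> x = affine_lift M' \<beta> (rmat Q *\<^sub>v x)"
proof -
  have "rmat Q *\<^sub>v affine_lift M \<alpha> x = rmat (Q * M) *\<^sub>v x + \<beta>"
    unfolding affine_lift_def \<beta>_def rmat_mult_mat_vec[OF Q M assms]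
    using Q M \<alpha> assms by (intro rmat_mult_add_vec) auto
  then show ?thesis
    unfolding QM rmat_mult_mat_vec[OF M' Q assms] affine_lift_def .
qed

lemma affine_lift_factor_funpow:
  assumes "x \<in> carrier_vec d"
  shows "rmat Q *\<^sub>v (affine_lift M \<alpha> ^^ n) x = (affine_lift M' \<beta> ^^ n) (rmat Q *\<^sub>v x)"
  using assms M \<alpha> by (induction n) (auto simp: affine_lift_factor)

lemma affine_map_factor:
  assumes "x \<in> carrier_vec d"
  shows "reduce_mod1 m (rmat Q *\<^sub>v affine_map d M \<alpha> x) = affine_map m M' \<beta> (reduce_mod1 m (rmat Q *\<^sub>v x))"
proof -
  have "reduce_mod1 m (rmat Q *\<^sub>v affine_map d M \<alpha> x) = reduce_mod1 m (rmat Q *\<^sub>v affine_lift M \<alpha> x)"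
    unfolding affine_map_eq_reduce[OF M \<alpha>]
    by (intro reduce_mod1_eqI cong_mod1_rmat[OF Q]) (use M \<alpha> in auto)
  then show ?thesis
    using affine_map_reduce_mod1[OF M' \<beta>] Q by (simp add: affine_lift_factor[OF assms])
qed

text \<open>The preimage of a closed invariant set under the factor map is closed and invariant. The
  section \<open>S\<close> shows that it is nonempty, and that \<open>A\<close> is everything once
  the preimage is.\<close>

lemma torus_minimal_factor:
  assumes "torus_minimal d (affine_map d M \<alpha>)"
  shows "torus_minimal m (affine_map m M' \<beta>)"
  unfolding torus_minimal_def
proof (intro allI impI, elim conjE)
  fix A assume ne: "A \<noteq> {}" and cl: "torus_closed m A" and inv: "affine_map m M' \<beta> ` A \<subseteq> A"
  have At: "A \<subseteq> torus m" using cl by (simp add: torus_closed_def)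
  define A' where "A' = {x \<in> torus d. reduce_mod1 m (rmat Q *\<^sub>v x) \<in> A}"
  have retract: "reduce_mod1 m (rmat Q *\<^sub>v reduce_mod1 d (rmat S *\<^sub>v y)) = y" if y: "y \<in> torus m" for y
  proof -
    have yc: "y \<in> carrier_vec m" using y by (rule torus_carrier)
    have "reduce_mod1 m (rmat Q *\<^sub>v reduce_mod1 d (rmat S *\<^sub>v y)) = reduce_mod1 m (rmat Q *\<^sub>v (rmat S *\<^sub>v y))"
      by (intro reduce_mod1_eqI cong_mod1_rmat[OF Q]) (use S in auto)
    then show ?thesis
      using rmat_mult_mat_vec[OF Q S yc] rmat_one_mult_vec[OF yc] reduce_mod1_torus_id[OF y]
      by (simp add: QS)
  qed
  obtain y where "y \<in> A" using ne by blast
  then have "reduce_mod1 d (rmat S *\<^sub>v y) \<in> A'"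
    using retract[of y] At by (auto simp: A'_def)
  then have "A' \<noteq> {}" by blast
  moreover have "affine_map d M \<alpha> ` A' \<subseteq> A'"
    using inv by (auto simp: A'_def affine_map_factor[OF torus_carrier] affine_map_eq_reduce[OF M \<alpha>, symmetric])
      (simp add: affine_map_eq_reduce[OF M \<alpha>])
  moreover have "torus_closed d A'"
    unfolding torus_closed_def torus_open_near
  proof (intro conjI ballI)
    obtain C where C: "C > 0" "\<And>e x y. e > 0 \<Longrightarrow> x \<in> carrier_vec d \<Longrightarrow> y \<in> carrier_vec d \<Longrightarrow>
        near_mod1 d e x y \<Longrightarrow> near_mod1 m (C * e) (rmat Q *\<^sub>v x) (rmat Q *\<^sub>v y)"
      using near_mod1_rmat[OF Q] by blast
    fix x assume x: "x \<in> torus d - A'"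
    then have "reduce_mod1 m (rmat Q *\<^sub>v x) \<in> torus m - A"
      by (auto simp: A'_def)
    then obtain e where e: "e > 0"
      "\<And>y. y \<in> torus m \<Longrightarrow> near_mod1 m e (reduce_mod1 m (rmat Q *\<^sub>v x)) y \<Longrightarrow> y \<in> torus m - A"
      using cl unfolding torus_closed_def torus_open_near by blast
    \<comment> \<open>A ball of radius \<open>e\<close> missing \<open>A\<close> pulls back to one
      of radius \<open>e / C\<close> missing \<open>A'\<close>, because \<open>Q\<close> is
      Lipschitz with constant \<open>C\<close>.\<close>
    have "y \<in> torus d - A'" if y: "y \<in> torus d" "near_mod1 d (e / C) x y" for y
    proof -
      have "near_mod1 m e (rmat Q *\<^sub>v x) (rmat Q *\<^sub>v y)"
        using C(2)[of "e / C" x y] C(1) e(1) x y by (auto simp: torus_carrier)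
      then have "near_mod1 m e (reduce_mod1 m (rmat Q *\<^sub>v x)) (reduce_mod1 m (rmat Q *\<^sub>v y))"
        by (meson cong_near_mod1 near_cong_mod1 cong_reduce_mod1)
      then have "reduce_mod1 m (rmat Q *\<^sub>v y) \<in> torus m - A" by (intro e(2)) auto
      then show ?thesis using y by (auto simp: A'_def)
    qed
    then show "\<exists>e>0. \<forall>y\<in>torus d. near_mod1 d e x y \<longrightarrow> y \<in> torus d - A'"
      using e(1) C(1) by (intro exI[of _ "e / C"]) auto
  qed (auto simp: A'_def)
  ultimately have A': "A' = torus d"
    using assms unfolding torus_minimal_def by blast
  have "y \<in> A" if "y \<in> torus m" for y
  proof -
    have "reduce_mod1 d (rmat S *\<^sub>v y) \<in> A'" unfolding A' by simp
    then show ?thesis using retract[OF that] by (simp add: A'_def)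
  qed
  then show "A = torus m" using At by blast
qed

end

section \<open>Fixed integer rows as characters, and large return times\<close>

text \<open>The last nonzero row in the sequence \<open>k\<close>, \<open>k N\<close>,
  \<open>k N^2\<close>, ... is annihilated by \<open>N\<close>.\<close>

lemma exists_left_kernel_row:
  fixes N k :: "'a :: semiring_1 mat"
  assumes N: "N \<in> carrier_mat d d"
  shows "k \<in> carrier_mat 1 d \<Longrightarrow> k \<noteq> 0\<^sub>m 1 d \<Longrightarrow> k * N ^\<^sub>m s = 0\<^sub>m 1 d \<Longrightarrow>
    \<exists>k'\<in>carrier_mat 1 d. k' \<noteq> 0\<^sub>m 1 d \<and> k' * N = 0\<^sub>m 1 d"
proof (induction s)
  case 0
  then show ?case using N by simp
next
  case (Suc s)
  have Ns: "N ^\<^sub>m s \<in> carrier_mat d d" using N by simp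
  have "k * N ^\<^sub>m s * N = 0\<^sub>m 1 d"
    using Suc.prems assoc_mult_mat[OF Suc.prems(1) Ns N] by simp
  moreover have "k * N ^\<^sub>m s \<in> carrier_mat 1 d"
    using Suc.prems(1) Ns by (rule mult_carrier_mat)
  ultimately show ?case using Suc by (cases "k * N ^\<^sub>m s = 0\<^sub>m 1 d") auto
qed

lemma not_Ints_gap:
  fixes t :: real assumes "t \<notin> \<int>"
  obtains e where "e > 0" "\<And>k::int. e \<le> \<bar>t - of_int k\<bar>"
proof
  have f: "frac t > 0" using assms by (simp add: frac_gt_0_iff)
  show "min (frac t) (1 - frac t) > 0" using f frac_lt_1[of t] by auto
  fix k :: int
  have "k \<le> \<lfloor>t\<rfloor> \<or> \<lfloor>t\<rfloor> + 1 \<le> k" by linarith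
  then have "real_of_int k \<le> of_int \<lfloor>t\<rfloor> \<or> real_of_int \<lfloor>t\<rfloor> + 1 \<le> of_int k" by linarith
  then show "min (frac t) (1 - frac t) \<le> \<bar>t - of_int k\<bar>"
    unfolding frac_def by linarith
qed

text \<open>A row fixed by \<open>M\<close> is a character of the torus along which the system is
  the rotation by \<open>k \<alpha>\<close>.\<close>

lemma rmat_fixed_row_affine_lift:
  assumes k: "k \<in> carrier_mat 1 d" and kM: "k * M = k"
    and M: "M \<in> carrier_mat d d" and \<alpha>: "\<alpha> \<in> carrier_vec d" and x: "x \<in> carrier_vec d"
  shows "(rmat k *\<^sub>v (affine_lift M \<alpha> ^^ n) x) $ 0 = (rmat k *\<^sub>v x) $ 0 + of_nat n * (rmat k *\<^sub>v \<alpha>) $ 0"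
proof (induction n)
  case (Suc n)
  have c: "(affine_lift M \<alpha> ^^ n) x \<in> carrier_vec d" (is "?y \<in> _") using M \<alpha> x by simp
  have "rmat k *\<^sub>v affine_lift M \<alpha> ?y = rmat (k * M) *\<^sub>v ?y + rmat k *\<^sub>v \<alpha>"
    unfolding affine_lift_def rmat_mult_mat_vec[OF k M c]
    using M \<alpha> c by (intro rmat_mult_add_vec[OF k]) auto
  then have "(rmat k *\<^sub>v affine_lift M \<alpha> ?y) $ 0 = (rmat k *\<^sub>v ?y) $ 0 + (rmat k *\<^sub>v \<alpha>) $ 0"
    using k by (simp add: kM)
  then show ?case using Suc by (simp add: algebra_simps)
qed simp

text \<open>If \<open>k \<alpha>\<close> were an integer, the kernel of the character
  \<open>k\<close> would be a closed invariant set, and it is proper because \<open>k\<close> is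
  nonzero.\<close>

lemma minimal_fixed_row_not_Ints:
  assumes k: "k \<in> carrier_mat 1 d" "k \<noteq> 0\<^sub>m 1 d" and kM: "k * M = k"
    and M: "M \<in> carrier_mat d d" and \<alpha>: "\<alpha> \<in> carrier_vec d"
    and min: "torus_minimal d (affine_map d M \<alpha>)"
  shows "(rmat k *\<^sub>v \<alpha>) $ 0 \<notin> \<int>"
proof
  assume int: "(rmat k *\<^sub>v \<alpha>) $ 0 \<in> \<int>"
  define A where "A = {x \<in> torus d. (rmat k *\<^sub>v x) $ 0 \<in> \<int>}"
  have "0\<^sub>v d \<in> A"
    using k by (auto simp: A_def torus_def scalar_prod_def)
  then have "A \<noteq> {}" by blast
  moreover have "affine_map d M \<alpha> ` A \<subseteq> A"
  proof (intro image_subsetI)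
    fix x assume x: "x \<in> A"
    then have xc: "x \<in> carrier_vec d" by (simp add: A_def torus_carrier)
    let ?y = "affine_lift M \<alpha> x"
    have "(rmat k *\<^sub>v ?y) $ 0 = (rmat k *\<^sub>v x) $ 0 + (rmat k *\<^sub>v \<alpha>) $ 0"
      using rmat_fixed_row_affine_lift[OF k(1) kM M \<alpha> xc, of 1] by simp
    then have "(rmat k *\<^sub>v ?y) $ 0 \<in> \<int>"
      using x int by (simp add: A_def)
    moreover have "cong_mod1 1 (rmat k *\<^sub>v reduce_mod1 d ?y) (rmat k *\<^sub>v ?y)"
      using M \<alpha> by (intro cong_mod1_rmat[OF k(1)]) auto
    ultimately have "(rmat k *\<^sub>v reduce_mod1 d ?y) $ 0 \<in> \<int>"
      unfolding cong_mod1_def by (metis Ints_add diff_add_cancel less_one)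
    then show "affine_map d M \<alpha> x \<in> A"
      by (simp add: A_def affine_map_eq_reduce[OF M \<alpha>])
  qed
  moreover have "torus_closed d A"
    unfolding torus_closed_def torus_open_near
  proof (intro conjI ballI)
    obtain C where C: "C > 0" "\<And>e x y. e > 0 \<Longrightarrow> x \<in> carrier_vec d \<Longrightarrow> y \<in> carrier_vec d \<Longrightarrow>
        near_mod1 d e x y \<Longrightarrow> near_mod1 1 (C * e) (rmat k *\<^sub>v x) (rmat k *\<^sub>v y)"
      using near_mod1_rmat[OF k(1)] by blast
    fix x assume x: "x \<in> torus d - A"
    then obtain e where e: "e > 0" "\<And>l::int. e \<le> \<bar>(rmat k *\<^sub>v x) $ 0 - of_int l\<bar>"
      using not_Ints_gap[of "(rmat k *\<^sub>v x) $ 0"] by (auto simp: A_def)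
    have "y \<notin> A" if y: "y \<in> torus d" "near_mod1 d (e / C) x y" for y
    proof
      assume "y \<in> A"
      then obtain l' :: int where l': "(rmat k *\<^sub>v y) $ 0 = of_int l'"
        by (auto simp: A_def elim: Ints_cases)
      have "near_mod1 1 e (rmat k *\<^sub>v x) (rmat k *\<^sub>v y)"
        using C(2)[of "e / C" x y] C(1) e(1) x y by (auto simp: torus_carrier)
      then obtain l :: int where "\<bar>(rmat k *\<^sub>v x) $ 0 - (rmat k *\<^sub>v y) $ 0 - of_int l\<bar> < e"
        unfolding near_mod1_def by auto
      then show False using e(2)[of "l' + l"] l' by simp
    qed
    then show "\<exists>e>0. \<forall>y\<in>torus d. near_mod1 d e x y \<longrightarrow> y \<in> torus d - A"
      using e(1) C(1) by (intro exI[of _ "e / C"]) auto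
  qed (auto simp: A_def)
  ultimately have A: "A = torus d"
    using min unfolding torus_minimal_def by blast
  obtain j where j: "j < d" "k $$ (0, j) \<noteq> 0"
    using k by (metis (no_types, lifting) carrier_matD eq_matI index_zero_mat less_one)
  \<comment> \<open>A point of the torus outside the kernel: \<open>k x\<close> is 1/2 or
    -1/2.\<close>
  define x where "x = vec d (\<lambda>i. if i = j then 1 / (2 * \<bar>real_of_int (k $$ (0, j))\<bar>) else 0)"
  have "1 \<le> \<bar>k $$ (0, j)\<bar>" using j by simp
  then have "(1::real) \<le> \<bar>of_int (k $$ (0, j))\<bar>" by linarith
  then have "x \<in> torus d"
    by (auto simp: x_def torus_def field_simps)
  then have "(rmat k *\<^sub>v x) $ 0 \<in> \<int>" using A by (auto simp: A_def)
  moreover have "(rmat k *\<^sub>v x) $ 0 = of_int (k $$ (0, j)) / (2 * \<bar>real_of_int (k $$ (0, j))\<bar>)"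
    using j by (subst index_rmat_mult_vec[OF k(1)])
      (auto simp: x_def if_distrib[of "\<lambda>t. _ * t"] cong: if_cong)
  moreover have "\<dots> = sgn (real_of_int (k $$ (0, j))) / 2"
    using j by (simp add: sgn_if)
  ultimately have "sgn (real_of_int (k $$ (0, j))) / 2 \<in> \<int>" by simp
  then obtain l :: int where l: "sgn (real_of_int (k $$ (0, j))) / 2 = of_int l"
    by (elim Ints_cases)
  have "sgn (real_of_int (k $$ (0, j))) = of_int (2 * l)" using l by simp
  moreover have "sgn (real_of_int (k $$ (0, j))) = of_int 1 \<or> sgn (real_of_int (k $$ (0, j))) = of_int (- 1)"
    using j by (auto simp: sgn_if)
  ultimately have "2 * l = 1 \<or> 2 * l = - 1" by (metis of_int_eq_iff)
  then show False by presburger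
qed

text \<open>Along a nonzero character fixed by \<open>M\<close> the orbit rotates by an irrational
  \<open>\<theta>\<close>, so the multiples \<open>n \<theta>\<close> with
  \<open>0 < n \<le> K\<close> stay a fixed distance away from the integers, and so does the
  displacement of the orbit.\<close>

lemma minimal_no_short_returns:
  assumes d: "d > 0" and M: "M \<in> carrier_mat d d" and \<alpha>: "\<alpha> \<in> carrier_vec d"
    and nil: "(M - 1\<^sub>m d) ^\<^sub>m s = 0\<^sub>m d d"
    and min: "torus_minimal d (affine_map d M \<alpha>)"
  obtains \<delta> where "\<delta> > 0"
    "\<And>n x x0. n > 0 \<Longrightarrow> n \<le> K \<Longrightarrow> x \<in> carrier_vec d \<Longrightarrow> x0 \<in> carrier_vec d \<Longrightarrow>
       near_mod1 d \<delta> x0 x \<Longrightarrow> \<not> near_mod1 d \<delta> x0 ((affine_lift M \<alpha> ^^ n) x)"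
proof -
  have N: "M - 1\<^sub>m d \<in> carrier_mat d d" using M by (intro minus_carrier_mat) simp
  \<comment> \<open>Any nonzero row can start the search for a fixed one; the all-ones row is
    nonzero because \<open>d > 0\<close>.\<close>
  let ?k0 = "mat 1 d (\<lambda>_. 1) :: int mat"
  have "?k0 $$ (0, 0) \<noteq> 0\<^sub>m 1 d $$ (0, 0)" using d by simp
  then have "?k0 \<noteq> 0\<^sub>m 1 d" by metis
  moreover have "?k0 * (M - 1\<^sub>m d) ^\<^sub>m s = 0\<^sub>m 1 d"
    unfolding nil by (rule right_mult_zero_mat) simp
  ultimately obtain k where k: "k \<in> carrier_mat 1 d" "k \<noteq> 0\<^sub>m 1 d" "k * (M - 1\<^sub>m d) = 0\<^sub>m 1 d"
    using exists_left_kernel_row[OF N, of ?k0 s] by auto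
  have kM: "k * M = k"
  proof -
    have "M = (M - 1\<^sub>m d) + 1\<^sub>m d" using M by (intro eq_matI) auto
    then have "k * M = k * (M - 1\<^sub>m d) + k * 1\<^sub>m d"
      using mult_add_distrib_mat[OF k(1) N, of "1\<^sub>m d"] by simp
    then show ?thesis using k by simp
  qed
  define \<theta> where "\<theta> = (rmat k *\<^sub>v \<alpha>) $ 0"
  \<comment> \<open>The multiple \<open>n k\<close> is again a nonzero fixed row, so minimality
    excludes integer values of \<open>n \<theta>\<close> and not only of
    \<open>\<theta>\<close>.\<close>
  have irr: "of_nat n * \<theta> \<notin> \<int>" if "n > 0" for n
  proof -
    have c: "int n \<cdot>\<^sub>m k \<in> carrier_mat 1 d" using k by simp
    obtain j where "j < d" "k $$ (0, j) \<noteq> 0"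
      using k by (metis (no_types, lifting) carrier_matD eq_matI index_zero_mat less_one)
    then have "(int n \<cdot>\<^sub>m k) $$ (0, j) \<noteq> 0\<^sub>m 1 d $$ (0, j)"
      using that k by simp
    then have "int n \<cdot>\<^sub>m k \<noteq> 0\<^sub>m 1 d" by metis
    moreover have "(int n \<cdot>\<^sub>m k) * M = int n \<cdot>\<^sub>m k"
      using mult_smult_assoc_mat[OF k(1) M] kM by simp
    ultimately have "(rmat (int n \<cdot>\<^sub>m k) *\<^sub>v \<alpha>) $ 0 \<notin> \<int>"
      using minimal_fixed_row_not_Ints[OF c _ _ M \<alpha> min] by blast
    moreover have "(rmat (int n \<cdot>\<^sub>m k) *\<^sub>v \<alpha>) $ 0 = of_nat n * \<theta>"
      unfolding \<theta>_def using index_rmat_mult_vec[OF c \<alpha>, of 0] index_rmat_mult_vec[OF k(1) \<alpha>, of 0] k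
      by (simp add: sum_distrib_left mult.assoc)
    ultimately show ?thesis by simp
  qed
  have "\<exists>e>0. n > 0 \<longrightarrow> (\<forall>l::int. e \<le> \<bar>of_nat n * \<theta> - of_int l\<bar>)" for n
  proof (cases "n > 0")
    case True
    then show ?thesis by (meson not_Ints_gap[OF irr])
  qed (auto intro: exI[of _ 1])
  then obtain e :: "nat \<Rightarrow> real" where e: "\<And>n. e n > 0"
    "\<And>n l. n > 0 \<Longrightarrow> e n \<le> \<bar>of_nat n * \<theta> - of_int l\<bar>" by metis
  obtain C where C: "C > 0" "\<And>e x y. e > 0 \<Longrightarrow> x \<in> carrier_vec d \<Longrightarrow> y \<in> carrier_vec d \<Longrightarrow>
      near_mod1 d e x y \<Longrightarrow> near_mod1 1 (C * e) (rmat k *\<^sub>v x) (rmat k *\<^sub>v y)"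
    using near_mod1_rmat[OF k(1)] by blast
  define f where "f = Min (e ` {..K})"
  have f: "f > 0" using e(1) by (simp add: f_def)
  have fe: "f \<le> e n" if "n \<le> K" for n using that by (simp add: f_def)
  show ?thesis
  \<comment> \<open>The 2 pays for the triangle inequality through \<open>x0\<close>, and
    \<open>C\<close> for the Lipschitz constant of the character.\<close>
  proof (rule that[of "f / (2 * C)"])
    show "f / (2 * C) > 0" using f C by simp
    fix n x x0 assume *: "n > 0" "n \<le> K" "x \<in> carrier_vec d" "x0 \<in> carrier_vec d"
      "near_mod1 d (f / (2 * C)) x0 x"
    show "\<not> near_mod1 d (f / (2 * C)) x0 ((affine_lift M \<alpha> ^^ n) x)"
    proof
      let ?y = "(affine_lift M \<alpha> ^^ n) x"
      assume "near_mod1 d (f / (2 * C)) x0 ?y"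
      then have "near_mod1 d (f / (2 * C) + f / (2 * C)) ?y x"
        using near_mod1_triangle[OF near_mod1_sym *(5)] by blast
      then have "near_mod1 1 (C * (f / (2 * C) + f / (2 * C))) (rmat k *\<^sub>v ?y) (rmat k *\<^sub>v x)"
        using f C(1) * M \<alpha> by (intro C(2)) auto
      moreover have "C * (f / (2 * C) + f / (2 * C)) = f" using C(1) by (simp add: field_simps)
      ultimately obtain l :: int where "\<bar>(rmat k *\<^sub>v ?y) $ 0 - (rmat k *\<^sub>v x) $ 0 - of_int l\<bar> < f"
        unfolding near_mod1_def by auto
      then have "\<bar>of_nat n * \<theta> - of_int l\<bar> < f"
        unfolding rmat_fixed_row_affine_lift[OF k(1) kM M \<alpha> *(3)] \<theta>_def by simp
      then show False using e(2)[OF *(1), of l] fe[OF *(2)] by linarith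
    qed
  qed
qed

section \<open>Perturbing unipotent orbits\<close>

text \<open>The translation cancels in the difference of two orbits, so a displacement of the
  starting point evolves linearly.\<close>

lemma affine_lift_funpow_add:
  assumes M: "M \<in> carrier_mat d d" and \<alpha>: "\<alpha> \<in> carrier_vec d"
  shows "x \<in> carrier_vec d \<Longrightarrow> w \<in> carrier_vec d \<Longrightarrow>
    (affine_lift M \<alpha> ^^ m) (x + w) = (affine_lift M \<alpha> ^^ m) x + rmat (M ^\<^sub>m m) *\<^sub>v w"
proof (induction m arbitrary: x w)
  case 0
  then show ?case using M by (simp add: rmat_one_mult_vec)
next
  case (Suc m)
  have c: "rmat M *\<^sub>v x \<in> carrier_vec d" "rmat M *\<^sub>v w \<in> carrier_vec d" using M by auto
  have "(p + q) + \<alpha> = (p + \<alpha>) + q" if "p \<in> carrier_vec d" "q \<in> carrier_vec d" for p q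
    using that \<alpha> by (intro eq_vecI) auto
  then have "affine_lift M \<alpha> (x + w) = affine_lift M \<alpha> x + rmat M *\<^sub>v w"
    unfolding affine_lift_def rmat_mult_add_vec[OF M Suc.prems] using c by blast
  moreover have "rmat (M ^\<^sub>m m) *\<^sub>v (rmat M *\<^sub>v w) = rmat (M ^\<^sub>m Suc m) *\<^sub>v w"
    using rmat_mult_mat_vec[of "M ^\<^sub>m m" d d M d w] M Suc.prems by simp
  moreover have "affine_lift M \<alpha> x \<in> carrier_vec d" using M \<alpha> by simp
  ultimately show ?case
    using Suc.IH[OF _ c(2), of "affine_lift M \<alpha> x"]
    by (simp add: funpow_Suc_right del: funpow.simps pow_mat.simps)
qed

text \<open>The sequence \<open>u\<close> is a Jordan chain, each term being the image of the
  previous one under \<open>M - 1\<close>. The formula is the binomial expansion of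
  \<open>(1 + N)^m\<close>, proved by Pascal's rule.\<close>

lemma unipotent_pow_chain:
  assumes M: "M \<in> carrier_mat d d"
    and u: "\<And>k. u k \<in> carrier_vec d" "\<And>k. rmat M *\<^sub>v u k = u k + u (Suc k)"
    and a: "a < d"
  shows "(rmat (M ^\<^sub>m m) *\<^sub>v u k) $ a = (\<Sum>l\<le>m. of_nat (m choose l) * u (k + l) $ a)"
proof (induction m arbitrary: k)
  case 0
  then show ?case using M u a by (simp add: rmat_one_mult_vec)
next
  case (Suc m)
  have Mm: "M ^\<^sub>m m \<in> carrier_mat d d" using M by simp
  have "rmat (M ^\<^sub>m Suc m) *\<^sub>v u k = rmat (M ^\<^sub>m m) *\<^sub>v u k + rmat (M ^\<^sub>m m) *\<^sub>v u (Suc k)"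
    using rmat_mult_mat_vec[OF Mm M u(1)] rmat_mult_add_vec[OF Mm u(1) u(1)] u(2) by simp
  moreover have "dim_vec (rmat (M ^\<^sub>m m) *\<^sub>v v) = d" for v :: "real vec"
    using M by auto
  ultimately have "(rmat (M ^\<^sub>m Suc m) *\<^sub>v u k) $ a
      = (\<Sum>l\<le>m. of_nat (m choose l) * u (k + l) $ a) + (\<Sum>l\<le>m. of_nat (m choose l) * u (Suc k + l) $ a)"
    using a by (simp only: index_add_vec Suc.IH)
  also have "(\<Sum>l\<le>m. of_nat (m choose l) * u (k + l) $ a)
      = (\<Sum>l\<le>Suc m. of_nat (m choose l) * u (k + l) $ a)" by simp
  also have "\<dots> = u k $ a + (\<Sum>l\<le>m. of_nat (m choose Suc l) * u (k + Suc l) $ a)"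
    by (subst sum.atMost_Suc_shift) simp
  also have "\<dots> + (\<Sum>l\<le>m. of_nat (m choose l) * u (Suc k + l) $ a)
      = u k $ a + (\<Sum>l\<le>m. of_nat (Suc m choose Suc l) * u (k + Suc l) $ a)"
    by (simp add: sum.distrib[symmetric] algebra_simps)
  also have "\<dots> = (\<Sum>l\<le>Suc m. of_nat (Suc m choose l) * u (k + l) $ a)"
    by (subst sum.atMost_Suc_shift) simp
  finally show ?case .
qed

lemma unipotent_pow_chain_truncated:
  assumes M: "M \<in> carrier_mat d d"
    and u: "\<And>k. u k \<in> carrier_vec d" "\<And>k. rmat M *\<^sub>v u k = u k + u (Suc k)"
    and vanish: "\<And>k. k > t \<Longrightarrow> u k = 0\<^sub>v d" and i: "i \<le> t" and a: "a < d"
  shows "(rmat (M ^\<^sub>m m) *\<^sub>v u (t - i)) $ a = (\<Sum>l\<le>i. of_nat (m choose l) * u (t - i + l) $ a)"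
proof -
  \<comment> \<open>Passing through \<open>max m i\<close> covers both orders: binomials vanish for
    \<open>l > m\<close>, chain vectors for \<open>l > i\<close>.\<close>
  have "(\<Sum>l\<le>m. of_nat (m choose l) * u (t - i + l) $ a) = (\<Sum>l\<le>max m i. of_nat (m choose l) * u (t - i + l) $ a)"
    by (intro sum.mono_neutral_left) auto
  also have "\<dots> = (\<Sum>l\<le>i. of_nat (m choose l) * u (t - i + l) $ a)"
    using vanish i a by (intro sum.mono_neutral_right) auto
  finally show ?thesis using unipotent_pow_chain[of M d u a m "t - i", OF M u a] by simp
qed

section \<open>Binomial asymptotics, interpolation and the perturbation vector\<close>

text \<open>The binomial is a product of \<open>i\<close> factors \<open>j n - k\<close> divided by
  \<open>i!\<close>; each factor divided by \<open>n\<close> tends to \<open>j\<close>.\<close>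

lemma tendsto_choose_scaled_diag:
  "(\<lambda>n. real (j * n choose i) / real n ^ i) \<longlonglongrightarrow> real j ^ i / fact i"
proof -
  have "(\<lambda>n. (\<Prod>k = 0..<i. real j - real k / real n) / fact i) \<longlonglongrightarrow> (\<Prod>k = 0..<i. real j - 0) / fact i"
    by (intro tendsto_intros tendsto_divide_0[OF tendsto_const] filterlim_real_sequentially
        filterlim_at_top_imp_at_infinity) simp
  then have lim: "(\<lambda>n. (\<Prod>k = 0..<i. real j - real k / real n) / fact i) \<longlonglongrightarrow> real j ^ i / fact i"
    by simp
  have ev: "\<forall>\<^sub>F n in sequentially. (\<Prod>k = 0..<i. real j - real k / real n) / fact i
      = real (j * n choose i) / real n ^ i"
  proof (rule eventually_sequentiallyI[of 1])
    fix n :: nat assume "n \<ge> 1"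
    then have "(\<Prod>k = 0..<i. real j - real k / real n) = (\<Prod>k = 0..<i. (real (j * n) - real k) / real n)"
      by (intro prod.cong) (auto simp: field_simps)
    also have "\<dots> = (\<Prod>k = 0..<i. real (j * n) - real k) / real n ^ i"
      by (simp add: prod_dividef)
    finally show "(\<Prod>k = 0..<i. real j - real k / real n) / fact i = real (j * n choose i) / real n ^ i"
      by (simp add: binomial_gbinomial gbinomial_prod_rev)
  qed
  show ?thesis using lim ev by (rule Lim_transform_eventually)
qed

text \<open>For \<open>l < i\<close> the diagonal limit is multiplied by the surplus factor
  \<open>n^-(i - l)\<close>, which tends to 0.\<close>

lemma tendsto_choose_scaled:
  assumes "l \<le> i"
  shows "(\<lambda>n. real (j * n choose l) / real n ^ i) \<longlonglongrightarrow> (if l = i then real j ^ i / fact i else 0)"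
proof (cases "l = i")
  case False
  have "(\<lambda>n. (real (j * n choose l) / real n ^ l) * (1 / real n) ^ (i - l)) \<longlonglongrightarrow> real j ^ l / fact l * 0 ^ (i - l)"
    by (intro tendsto_intros tendsto_choose_scaled_diag tendsto_divide_0[OF tendsto_const]
        filterlim_real_sequentially filterlim_at_top_imp_at_infinity)
  moreover have "(real (j * n choose l) / real n ^ l) * (1 / real n) ^ (i - l) = real (j * n choose l) / real n ^ i" for n
  proof -
    have "real n ^ i = real n ^ l * real n ^ (i - l)"
      using assms by (simp add: power_add[symmetric])
    then show ?thesis by (simp add: power_divide)
  qed
  ultimately show ?thesis using False assms by (simp add: zero_power)
qed (simp add: tendsto_choose_scaled_diag)

lemma choose_scaled_uniform:
  assumes "\<eta> > 0"
  obtains K :: nat where "K > 0" "\<And>n j i l. n \<ge> K \<Longrightarrow> j \<le> r \<Longrightarrow> i \<le> r \<Longrightarrow> l \<le> i \<Longrightarrow>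
    \<bar>real (j * n choose l) / real n ^ i - (if l = i then real j ^ i / fact i else 0)\<bar> < \<eta>"
proof -
  have "\<forall>\<^sub>F n in sequentially. \<forall>j\<in>{..r}. \<forall>i\<in>{..r}. \<forall>l\<in>{..i}.
    \<bar>real (j * n choose l) / real n ^ i - (if l = i then real j ^ i / fact i else 0)\<bar> < \<eta>"
    using tendstoD[OF tendsto_choose_scaled assms]
    by (intro eventually_ball_finite ballI) (auto simp: dist_real_def)
  then obtain K where "\<And>n. n \<ge> K \<Longrightarrow> \<forall>j\<in>{..r}. \<forall>i\<in>{..r}. \<forall>l\<in>{..i}.
    \<bar>real (j * n choose l) / real n ^ i - (if l = i then real j ^ i / fact i else 0)\<bar> < \<eta>"
    by (auto simp: eventually_sequentially)
  then show ?thesis by (intro that[of "Suc K"]) auto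
qed

text \<open>Row \<open>j\<close> consists of the coefficients of the Lagrange polynomial for the
  nodes 0, ..., \<open>r\<close> that is 1 at \<open>j\<close>. Since 0 is a node different from
  \<open>j\<close>, its constant term vanishes and the sum may start at
  \<open>i = 1\<close>.\<close>

lemma lagrange_coefficients:
  fixes r :: nat
  obtains A :: "nat \<Rightarrow> nat \<Rightarrow> real" where
    "\<And>j k. j \<in> {1..r} \<Longrightarrow> k \<le> r \<Longrightarrow> (\<Sum>i = 1..r. A j i * real k ^ i) = (if k = j then 1 else 0)"
proof
  define L :: "nat \<Rightarrow> real poly" where
    "L j = (\<Prod>m\<in>{..r} - {j}. smult (1 / (real j - real m)) [:- real m, 1:])" for j
  fix j k assume j: "j \<in> {1..r}" and k: "k \<le> r"
  have poly_L: "poly (L j) (real k) = (if k = j then 1 else 0)" if "k \<le> r" for k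
  proof -
    have "poly (L j) (real k) = (\<Prod>m\<in>{..r} - {j}. (real k - real m) / (real j - real m))"
      by (simp add: L_def poly_prod diff_divide_distrib)
    also have "\<dots> = (if k = j then 1 else 0)"
      using that by (auto intro!: prod.neutral)
    finally show ?thesis .
  qed
  have "degree (L j) \<le> (\<Sum>m\<in>{..r} - {j}. degree (smult (1 / (real j - real m)) [:- real m, 1:]))"
    unfolding L_def by (rule order_trans[OF degree_prod_sum_le]) (auto simp: o_def)
  also have "\<dots> \<le> (\<Sum>m\<in>{..r} - {j}. 1)"
    by (intro sum_mono) (auto intro: order_trans[OF degree_smult_le])
  also have "\<dots> = r" using j by simp
  finally have deg: "degree (L j) \<le> r" .
  have "poly (L j) 0 = 0" using poly_L[of 0] j by simp
  then have c0: "coeff (L j) 0 = 0" by (simp add: poly_0_coeff_0)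
  have "poly (L j) (real k) = (\<Sum>i\<le>r. coeff (L j) i * real k ^ i)"
    unfolding poly_altdef using deg
    by (intro sum.mono_neutral_left) (auto simp: coeff_eq_0)
  also have "\<dots> = (\<Sum>i = 1..r. coeff (L j) i * real k ^ i)"
    using c0 by (intro sum.mono_neutral_right) (auto simp: not_le)
  finally show "(\<Sum>i = 1..r. coeff (L j) i * real k ^ i) = (if k = j then 1 else 0)"
    using poly_L[OF k] by simp
qed

lemma index_rmat_mult_vec_sum:
  assumes B: "B \<in> carrier_mat m d" and v: "\<And>i. v i \<in> carrier_vec d" and a: "a < m"
  shows "(rmat B *\<^sub>v vec d (\<lambda>b. \<Sum>i\<in>I. f i * v i $ b)) $ a = (\<Sum>i\<in>I. f i * (rmat B *\<^sub>v v i) $ a)"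
proof -
  have "(rmat B *\<^sub>v vec d (\<lambda>b. \<Sum>i\<in>I. f i * v i $ b)) $ a
      = (\<Sum>b<d. \<Sum>i\<in>I. f i * (of_int (B $$ (a, b)) * v i $ b))"
    by (subst index_rmat_mult_vec[OF B _ a]) (auto simp: sum_distrib_left mult_ac intro!: sum.cong)
  also have "\<dots> = (\<Sum>i\<in>I. \<Sum>b<d. f i * (of_int (B $$ (a, b)) * v i $ b))"
    by (rule sum.swap)
  also have "\<dots> = (\<Sum>i\<in>I. f i * (rmat B *\<^sub>v v i) $ a)"
    by (simp only: index_rmat_mult_vec[OF B v a] sum_distrib_left mult.assoc)
  finally show ?thesis .
qed

text \<open>In the orbit of \<open>u (t - i) / n^i\<close> at time \<open>j n\<close> only the last
  chain vector \<open>u t\<close> survives as \<open>n\<close> grows, with coefficient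
  \<open>j^i / i!\<close>. Combining \<open>i = 1..r\<close> realises any prescribed
  \<open>h\<close> vanishing at 0. The threshold \<open>K\<close> is uniform over bounded
  \<open>h\<close>, as \<open>h\<close> will be known only after \<open>n\<close> is chosen.\<close>

lemma unipotent_perturbation:
  assumes M: "M \<in> carrier_mat d d"
    and u: "\<And>k. u k \<in> carrier_vec d" "\<And>k. rmat M *\<^sub>v u k = u k + u (Suc k)"
    and vanish: "\<And>k. k > t \<Longrightarrow> u k = 0\<^sub>v d" and rt: "r \<le> t" and \<epsilon>: "\<epsilon> > 0"
  obtains K where "\<And>n h. n \<ge> K \<Longrightarrow> (\<And>j. \<bar>h j\<bar> \<le> 1) \<Longrightarrow> h 0 = 0 \<Longrightarrow>
    \<exists>w\<in>carrier_vec d. \<forall>j\<le>r. \<forall>a<d. \<bar>(rmat (M ^\<^sub>m (j * n)) *\<^sub>v w) $ a - h j * u t $ a\<bar> < \<epsilon>"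
proof -
  obtain A :: "nat \<Rightarrow> nat \<Rightarrow> real" where A:
    "\<And>j k. j \<in> {1..r} \<Longrightarrow> k \<le> r \<Longrightarrow> (\<Sum>i = 1..r. A j i * real k ^ i) = (if k = j then 1 else 0)"
    using lagrange_coefficients[of r] by metis
  \<comment> \<open>A bound for the coefficient \<open>c i\<close> below that does not depend on
    \<open>h\<close>.\<close>
  define Cm where "Cm i = fact i * (\<Sum>j = 1..r. \<bar>A j i\<bar>)" for i
  define Bd where "Bd = (\<Sum>k\<le>t. \<Sum>a<d. \<bar>u k $ a\<bar>)"
  have Bd: "\<bar>u k $ a\<bar> \<le> Bd" if "k \<le> t" "a < d" for k a
  proof -
    have "\<bar>u k $ a\<bar> \<le> (\<Sum>a<d. \<bar>u k $ a\<bar>)"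
      using that by (intro member_le_sum) auto
    also have "\<dots> \<le> Bd"
      unfolding Bd_def using that by (intro member_le_sum) (auto intro: sum_nonneg)
    finally show ?thesis .
  qed
  have Bd0: "Bd \<ge> 0" by (auto simp: Bd_def intro!: sum_nonneg)
  have Cm0: "Cm i \<ge> 0" for i by (auto simp: Cm_def intro!: mult_nonneg_nonneg sum_nonneg)
  define G where "G = (\<Sum>i = 1..r. \<Sum>l\<le>i. Cm i * Bd)"
  have G0: "G \<ge> 0" using Bd0 Cm0 by (auto simp: G_def intro!: sum_nonneg mult_nonneg_nonneg)
  \<comment> \<open>The total error is at most \<open>G * \<eta>\<close>; the 1 in the denominator
    makes this smaller than \<open>\<epsilon>\<close> and avoids dividing by 0.\<close>
  define \<eta> where "\<eta> = \<epsilon> / (G + 1)"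
  have \<eta>: "\<eta> > 0" using \<epsilon> G0 by (simp add: \<eta>_def)
  obtain K where K: "K > 0" "\<And>n j i l. n \<ge> K \<Longrightarrow> j \<le> r \<Longrightarrow> i \<le> r \<Longrightarrow> l \<le> i \<Longrightarrow>
    \<bar>real (j * n choose l) / real n ^ i - (if l = i then real j ^ i / fact i else 0)\<bar> < \<eta>"
    using choose_scaled_uniform[OF \<eta>] by blast
  show ?thesis
  proof (rule that[of K])
    fix n and h :: "nat \<Rightarrow> real"
    assume n: "n \<ge> K" and h: "\<And>j. \<bar>h j\<bar> \<le> 1" "h 0 = 0"
    \<comment> \<open>The factorial cancels the \<open>i!\<close> in the limit of the scaled
      binomials, so that interpolation applies.\<close>
    define c where "c i = fact i * (\<Sum>j = 1..r. A j i * h j)" for i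
    have c_le: "\<bar>c i\<bar> \<le> Cm i" for i
    proof -
      have "\<bar>\<Sum>j = 1..r. A j i * h j\<bar> \<le> (\<Sum>j = 1..r. \<bar>A j i\<bar>)"
        using h(1) by (intro order_trans[OF sum_abs] sum_mono) (simp add: abs_mult mult_left_le)
      then show ?thesis by (simp add: c_def Cm_def abs_mult)
    qed
    have interp: "(\<Sum>i = 1..r. c i * (real j ^ i / fact i)) = h j" if j: "j \<le> r" for j
    proof -
      have "(\<Sum>i = 1..r. c i * (real j ^ i / fact i)) = (\<Sum>i = 1..r. \<Sum>k = 1..r. h k * (A k i * real j ^ i))"
        by (auto simp: c_def sum_distrib_right sum_distrib_left mult_ac intro!: sum.cong)
      also have "\<dots> = (\<Sum>k = 1..r. h k * (\<Sum>i = 1..r. A k i * real j ^ i))"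
        by (subst sum.swap) (simp add: sum_distrib_left)
      also have "\<dots> = (\<Sum>k = 1..r. if k = j then h k else 0)"
        using A j by (intro sum.cong) auto
      also have "\<dots> = h j" using j h(2) by (cases "j = 0") auto
      finally show ?thesis .
    qed
    define w where "w = vec d (\<lambda>b. \<Sum>i\<in>{1..r}. (c i / real n ^ i) * u (t - i) $ b)"
    have "\<bar>(rmat (M ^\<^sub>m (j * n)) *\<^sub>v w) $ a - h j * u t $ a\<bar> < \<epsilon>" if j: "j \<le> r" and a: "a < d" for j a
    proof -
      define \<theta> where "\<theta> i l = real (j * n choose l) / real n ^ i - (if l = i then real j ^ i / fact i else 0)" for i l
      have "(rmat (M ^\<^sub>m (j * n)) *\<^sub>v w) $ a
          = (\<Sum>i = 1..r. (c i / real n ^ i) * (rmat (M ^\<^sub>m (j * n)) *\<^sub>v u (t - i)) $ a)"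
        unfolding w_def by (rule index_rmat_mult_vec_sum[OF pow_carrier_mat[OF M] u(1) a])
      also have "\<dots> = (\<Sum>i = 1..r. \<Sum>l\<le>i. c i * (real (j * n choose l) / real n ^ i) * u (t - i + l) $ a)"
        using rt by (intro sum.cong refl)
          (simp add: unipotent_pow_chain_truncated[of M d u t, OF M u vanish _ a] sum_distrib_left mult.assoc)
      finally have 1: "(rmat (M ^\<^sub>m (j * n)) *\<^sub>v w) $ a
          = (\<Sum>i = 1..r. \<Sum>l\<le>i. c i * (real (j * n choose l) / real n ^ i) * u (t - i + l) $ a)" .
      have "h j * u t $ a = (\<Sum>i = 1..r. c i * (real j ^ i / fact i) * u t $ a)"
        unfolding interp[OF j, symmetric] by (simp add: sum_distrib_right)
      \<comment> \<open>Written as a double sum supported on \<open>l = i\<close>, so that it can be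
        subtracted termwise.\<close>
      also have "\<dots> = (\<Sum>i = 1..r. \<Sum>l\<le>i. c i * (if l = i then real j ^ i / fact i else 0) * u (t - i + l) $ a)"
      proof (intro sum.cong refl)
        fix i assume "i \<in> {1..r}"
        then have "t - i + i = t" using rt by simp
        then have "(\<Sum>l\<le>i. c i * (if l = i then real j ^ i / fact i else 0) * u (t - i + l) $ a)
            = (\<Sum>l\<le>i. if l = i then c i * (real j ^ i / fact i) * u t $ a else 0)"
          by (intro sum.cong) auto
        then show "c i * (real j ^ i / fact i) * u t $ a
            = (\<Sum>l\<le>i. c i * (if l = i then real j ^ i / fact i else 0) * u (t - i + l) $ a)"
          by simp
      qed
      finally have "(rmat (M ^\<^sub>m (j * n)) *\<^sub>v w) $ a - h j * u t $ a
          = (\<Sum>i = 1..r. \<Sum>l\<le>i. c i * \<theta> i l * u (t - i + l) $ a)"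
        unfolding 1 \<theta>_def by (simp only: sum_subtractf[symmetric] left_diff_distrib right_diff_distrib)
      also have "\<bar>\<dots>\<bar> \<le> (\<Sum>i = 1..r. \<Sum>l\<le>i. Cm i * \<eta> * Bd)"
      proof (intro order_trans[OF sum_abs sum_mono])
        fix i l assume *: "i \<in> {1..r}" "l \<in> {..i}"
        have "\<bar>\<theta> i l\<bar> \<le> \<eta>"
          unfolding \<theta>_def using less_imp_le[OF K(2)[OF n j, of i l]] * by simp
        moreover have "\<bar>u (t - i + l) $ a\<bar> \<le> Bd"
          using * rt a by (intro Bd) auto
        ultimately show "\<bar>c i * \<theta> i l * u (t - i + l) $ a\<bar> \<le> Cm i * \<eta> * Bd"
          unfolding abs_mult using c_le[of i] Cm0 \<eta> by (intro mult_mono) auto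
      qed
      also have "\<dots> = G * \<eta>"
        by (simp only: G_def sum_distrib_right) (simp add: mult_ac)
      also have "\<dots> < \<epsilon>"
        using \<epsilon> G0 by (simp add: \<eta>_def field_simps)
      finally show ?thesis .
    qed
    then show "\<exists>w\<in>carrier_vec d. \<forall>j\<le>r. \<forall>a<d. \<bar>(rmat (M ^\<^sub>m (j * n)) *\<^sub>v w) $ a - h j * u t $ a\<bar> < \<epsilon>"
      by (intro bexI[of _ w]) (auto simp: w_def)
  qed
qed

section \<open>Lifting recurrence from the quotient by a circle\<close>

text \<open>A recurrent orbit of the factor near \<open>Q x0\<close> lifts to one that differs from
  \<open>x0\<close>, up to a small error and lattice vectors, only along \<open>E\<close>. As
  \<open>u t\<close> is a nonzero multiple of \<open>E\<close>,
  \<open>unipotent_perturbation\<close> cancels these deviations at all times \<open>j n\<close> at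
  once.\<close>

lemma affine_lift_recurrence_lifting:
  assumes M: "M \<in> carrier_mat d d" and \<alpha>: "\<alpha> \<in> carrier_vec d"
    and m: "m > 0" and M': "M' \<in> carrier_mat m m"
    and Q: "Q \<in> carrier_mat m d" and S: "S \<in> carrier_mat d m"
    and E: "E \<in> carrier_mat d 1" and P: "P \<in> carrier_mat 1 d"
    and QS: "Q * S = 1\<^sub>m m" and SQEP: "S * Q + E * P = 1\<^sub>m d" and QM: "Q * M = M' * Q"
    and nil: "(M' - 1\<^sub>m m) ^\<^sub>m s = 0\<^sub>m m m"
    and min: "torus_minimal m (affine_map m M' (rmat Q *\<^sub>v \<alpha>))"
    and u: "\<And>k. u k \<in> carrier_vec d" "\<And>k. rmat M *\<^sub>v u k = u k + u (Suc k)"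
    and vanish: "\<And>k. k > t \<Longrightarrow> u k = 0\<^sub>v d"
    and ut: "\<And>a. a < d \<Longrightarrow> u t $ a = of_int g * of_int (E $$ (a, 0))" and g: "g \<noteq> 0"
    and r: "1 \<le> r" "r \<le> t" and R0: "0 \<notin> R"
    and rec: "\<forall>y0\<in>carrier_vec m. \<forall>e>0. \<exists>n\<in>R. \<exists>y\<in>carrier_vec m. \<forall>j\<le>r.
            near_mod1 m e y0 ((affine_lift M' (rmat Q *\<^sub>v \<alpha>) ^^ (j * n)) y)"
    and x0: "x0 \<in> carrier_vec d" and e: "e > 0"
  shows "\<exists>n\<in>R. \<exists>x\<in>carrier_vec d. \<forall>j\<le>r. near_mod1 d e x0 ((affine_lift M \<alpha> ^^ (j * n)) x)"
proof -
  interpret integer_factor m d M M' Q S \<alpha>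
    using M \<alpha> M' Q S QS QM by unfold_locales
  note rec = rec[folded \<beta>_def] and min = min[folded \<beta>_def]
  define y0 where "y0 = rmat Q *\<^sub>v x0"
  have y0: "y0 \<in> carrier_vec m" using Q by (simp add: y0_def)
  obtain K where K: "\<And>n h. n \<ge> K \<Longrightarrow> (\<And>j. \<bar>h j\<bar> \<le> 1) \<Longrightarrow> h 0 = 0 \<Longrightarrow>
    \<exists>w\<in>carrier_vec d. \<forall>j\<le>r. \<forall>a<d. \<bar>(rmat (M ^\<^sub>m (j * n)) *\<^sub>v w) $ a - h j * u t $ a\<bar> < e / 2"
    using unipotent_perturbation[of M d u t r "e / 2", OF M u vanish r(2)] e by auto
  obtain \<delta> where \<delta>: "\<delta> > 0" "\<And>n x x0. n > 0 \<Longrightarrow> n \<le> K \<Longrightarrow> x \<in> carrier_vec m \<Longrightarrow> x0 \<in> carrier_vec m \<Longrightarrow>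
       near_mod1 m \<delta> x0 x \<Longrightarrow> \<not> near_mod1 m \<delta> x0 ((affine_lift M' \<beta> ^^ n) x)"
    using minimal_no_short_returns[OF m M' \<beta> nil min, of K] by blast
  obtain C where C: "C > 0" "\<And>e x y. e > 0 \<Longrightarrow> x \<in> carrier_vec m \<Longrightarrow> y \<in> carrier_vec m \<Longrightarrow>
      near_mod1 m e x y \<Longrightarrow> near_mod1 d (C * e) (rmat S *\<^sub>v x) (rmat S *\<^sub>v y)"
    using near_mod1_rmat[OF S] by blast
  \<comment> \<open>Closeness \<open>\<delta>\<close> forces \<open>n \<ge> K\<close>; closeness
    \<open>e / (2 * C)\<close> leaves an error of at most \<open>e / 2\<close> after applying
    \<open>S\<close>.\<close>
  define \<gamma> where "\<gamma> = min \<delta> (e / (2 * C))"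
  have \<gamma>: "\<gamma> > 0" "\<gamma> \<le> \<delta>" "C * \<gamma> \<le> e / 2"
    using \<delta>(1) C(1) e by (auto simp: \<gamma>_def min_def field_simps)
  obtain n y where n: "n \<in> R" and y: "y \<in> carrier_vec m"
    and ny: "\<And>j. j \<le> r \<Longrightarrow> near_mod1 m \<gamma> y0 ((affine_lift M' \<beta> ^^ (j * n)) y)"
    using bspec[OF rec y0] \<gamma>(1) by metis
  have "n > 0" using n R0 by (cases n) auto
  \<comment> \<open>Otherwise the times \<open>j = 0\<close> and \<open>j = 1\<close> would give a
    return too short to be possible.\<close>
  have "n \<ge> K"
  proof (rule ccontr)
    assume "\<not> n \<ge> K"
    then show False
      using \<delta>(2)[OF \<open>n > 0\<close> _ y y0] ny[of 0] ny[of 1] r near_mod1_mono[OF _ \<gamma>(2)] by simp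
  qed
  \<comment> \<open>The lift of \<open>y\<close> obtained by moving \<open>x0\<close> only in the
    directions of \<open>S\<close>.\<close>
  define x where "x = x0 + rmat S *\<^sub>v (y - y0)"
  have x: "x \<in> carrier_vec d" using x0 S by (simp add: x_def)
  have Qx: "rmat Q *\<^sub>v x = y"
  proof -
    have "y - y0 \<in> carrier_vec m" using y y0 by simp
    then have "rmat Q *\<^sub>v x = y0 + (y - y0)"
      unfolding x_def using rmat_mult_add_vec[OF Q x0, of "rmat S *\<^sub>v (y - y0)"]
        rmat_mult_mat_vec[OF Q S, of "y - y0"] S by (simp add: QS rmat_one_mult_vec y0_def)
    also have "\<dots> = y" using y y0 by (intro eq_vecI) auto
    finally show ?thesis .
  qed
  define X where "X j = (affine_lift M \<alpha> ^^ (j * n)) x" for j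
  define Y where "Y j = (affine_lift M' \<beta> ^^ (j * n)) y" for j
  have X: "X j \<in> carrier_vec d" for j using M \<alpha> x by (simp add: X_def)
  have Y: "Y j \<in> carrier_vec m" for j using M' \<beta> y by (simp add: Y_def)
  have QX: "rmat Q *\<^sub>v X j = Y j" for j
    unfolding X_def Y_def affine_lift_factor_funpow[OF x] Qx ..
  \<comment> \<open>The component of \<open>X j - x0\<close> along \<open>E\<close>. At
    \<open>j = 0\<close> it is set to 0, matching \<open>X 0 - x0 = S (y - y0)\<close>; this gives
    \<open>h 0 = 0\<close>.\<close>
  define \<tau> where "\<tau> j = (if j = 0 then 0 else (rmat P *\<^sub>v (X j - x0)) $ 0)" for j
  have decomp: "X j $ a - x0 $ a = (rmat S *\<^sub>v Y j) $ a - (rmat S *\<^sub>v y0) $ a + \<tau> j * of_int (E $$ (a, 0))"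
    if a: "a < d" for j a
  proof -
    have S_diff: "rmat S *\<^sub>v (v - y0) = rmat S *\<^sub>v v - rmat S *\<^sub>v y0" if "v \<in> carrier_vec m" for v
      using S that y0 by (intro mult_minus_distrib_mat_vec[of _ d m]) auto
    show ?thesis
    proof (cases "j = 0")
      case True
      then show ?thesis
        using a x0 S S_diff[OF y] by (simp add: X_def Y_def x_def \<tau>_def)
    next
      case False
      define z where "z = X j - x0"
      have z: "z \<in> carrier_vec d" using X x0 by (simp add: z_def)
      have "z = rmat (S * Q + E * P) *\<^sub>v z" using z by (simp add: SQEP rmat_one_mult_vec)
      also have "rmat (S * Q + E * P) = rmat (S * Q) + rmat (E * P)"
        using S Q E P by (intro eq_matI) auto
      also have "\<dots> *\<^sub>v z = rmat (S * Q) *\<^sub>v z + rmat (E * P) *\<^sub>v z"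
        using S Q E P z by (intro add_mult_distrib_mat_vec[of _ d d]) auto
      also have "\<dots> = rmat S *\<^sub>v (rmat Q *\<^sub>v z) + rmat E *\<^sub>v (rmat P *\<^sub>v z)"
        using rmat_mult_mat_vec[OF S Q z] rmat_mult_mat_vec[OF E P z] by simp
      also have "rmat Q *\<^sub>v z = Y j - y0"
        using mult_minus_distrib_mat_vec[of "rmat Q" m d "X j" x0] Q X x0 by (simp add: z_def QX y0_def)
      finally have "z = rmat S *\<^sub>v Y j - rmat S *\<^sub>v y0 + rmat E *\<^sub>v (rmat P *\<^sub>v z)"
        by (simp add: S_diff[OF Y])
      moreover have "(rmat E *\<^sub>v (rmat P *\<^sub>v z)) $ a = of_int (E $$ (a, 0)) * (rmat P *\<^sub>v z) $ 0"
        using index_rmat_mult_vec[OF E _ a, of "rmat P *\<^sub>v z"] P by simp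
      ultimately have "z $ a = (rmat S *\<^sub>v Y j) $ a - (rmat S *\<^sub>v y0) $ a + of_int (E $$ (a, 0)) * (rmat P *\<^sub>v z) $ 0"
        using a S E by (metis (no_types, lifting) carrier_matD(1) dim_mult_mat_vec index_add_vec(1)
            index_map_mat(2) index_minus_vec)
      then show ?thesis using a X x0 False by (simp add: z_def \<tau>_def)
    qed
  qed
  \<comment> \<open>The integer part of \<open>\<tau> j\<close> contributes a lattice vector, so
    only the fractional part has to be cancelled; dividing by \<open>g\<close> accounts for
    \<open>u t\<close> being \<open>g\<close> times \<open>E\<close>.\<close>
  define h where "h j = - frac (\<tau> j) / of_int g" for j
  have h_le: "\<bar>h j\<bar> \<le> 1" for j
  proof -
    have "1 \<le> \<bar>g\<bar>" using g by simp
    then have "(1::real) \<le> \<bar>of_int g\<bar>" by linarith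
    moreover have "frac (\<tau> j) < 1" by (rule frac_lt_1)
    ultimately have "frac (\<tau> j) \<le> \<bar>of_int g\<bar>" by linarith
    then show ?thesis using g by (simp add: h_def divide_le_eq)
  qed
  have "h 0 = 0" by (simp add: h_def \<tau>_def)
  then obtain w where w: "w \<in> carrier_vec d"
    "\<And>j a. j \<le> r \<Longrightarrow> a < d \<Longrightarrow> \<bar>(rmat (M ^\<^sub>m (j * n)) *\<^sub>v w) $ a - h j * u t $ a\<bar> < e / 2"
    using K[of n h, OF \<open>n \<ge> K\<close> h_le] by blast
  have "near_mod1 d e x0 ((affine_lift M \<alpha> ^^ (j * n)) (x + w))" if j: "j \<le> r" for j
    unfolding near_mod1_def
  proof (intro allI impI)
    fix a assume a: "a < d"
    have "near_mod1 m \<gamma> y0 (Y j)" using ny[OF j] by (simp add: Y_def)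
    then have "near_mod1 d (C * \<gamma>) (rmat S *\<^sub>v y0) (rmat S *\<^sub>v Y j)"
      using C(2) \<gamma>(1) y0 Y by blast
    then obtain k :: int where "\<bar>(rmat S *\<^sub>v y0) $ a - (rmat S *\<^sub>v Y j) $ a - of_int k\<bar> < C * \<gamma>"
      using a unfolding near_mod1_def by blast
    then have k: "\<bar>(rmat S *\<^sub>v y0) $ a - (rmat S *\<^sub>v Y j) $ a - of_int k\<bar> < e / 2"
      using \<gamma>(3) by linarith
    have "(affine_lift M \<alpha> ^^ (j * n)) (x + w) $ a = X j $ a + (rmat (M ^\<^sub>m (j * n)) *\<^sub>v w) $ a"
      unfolding affine_lift_funpow_add[OF M \<alpha> x w(1)] X_def using a M by auto
    moreover have "h j * u t $ a = - (frac (\<tau> j) * of_int (E $$ (a, 0)))"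
      using g by (simp add: ut[OF a] h_def)
    moreover have "\<tau> j * of_int (E $$ (a, 0)) = frac (\<tau> j) * of_int (E $$ (a, 0)) + of_int (\<lfloor>\<tau> j\<rfloor> * E $$ (a, 0))"
      by (simp add: frac_def algebra_simps)
    ultimately have "\<bar>x0 $ a - (affine_lift M \<alpha> ^^ (j * n)) (x + w) $ a - of_int (k - \<lfloor>\<tau> j\<rfloor> * E $$ (a, 0))\<bar> < e"
      using decomp[OF a, of j] k w(2)[OF j a] unfolding of_int_diff by linarith
    then show "\<exists>k::int. \<bar>x0 $ a - (affine_lift M \<alpha> ^^ (j * n)) (x + w) $ a - of_int k\<bar> < e" by blast
  qed
  then show ?thesis using n x w(1) by (meson add_carrier_vec)
qed


section \<open>Induction on the dimension\<close>

lemma pow_mat_left_commute: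
  fixes N :: "'a :: semiring_1 mat"
  assumes "N \<in> carrier_mat d d"
  shows "N * N ^\<^sub>m k = N ^\<^sub>m Suc k"
proof (induction k)
  case (Suc k)
  have "N * N ^\<^sub>m Suc k = (N * N ^\<^sub>m k) * N"
    using assoc_mult_mat[OF assms pow_carrier_mat[OF assms] assms] by simp
  then show ?case using Suc by simp
qed (use assms in simp)

lemma pow_mat_eq_zero_mono:
  fixes N :: "'a :: semiring_1 mat"
  assumes N: "N \<in> carrier_mat d d" and "N ^\<^sub>m s = 0\<^sub>m d d" and "k \<ge> s"
  shows "N ^\<^sub>m k = 0\<^sub>m d d"
  using assms(3)
proof (induction k rule: dec_induct)
  case (step k)
  then show ?case using N left_mult_zero_mat[OF N] by simp
qed fact

text \<open>Dividing by one circle lowers the dimension but perhaps not the step, hence the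
  induction on \<open>d\<close> for fixed \<open>s\<close>. It stops when \<open>N^(s-1)\<close>
  vanishes, where the hypothesis on \<open>R\<close> applies.\<close>

lemma minimal_affine_lift_recurrence:
  assumes s: "s \<ge> 2" and r: "1 \<le> r" "r \<le> s - 1" and rec: "recurrence_set_affine r (s - 1) R"
  shows "affine_system s d M \<alpha> \<Longrightarrow> torus_minimal d (affine_map d M \<alpha>) \<Longrightarrow>
    \<forall>x0\<in>carrier_vec d. \<forall>e>0. \<exists>n\<in>R. \<exists>x\<in>carrier_vec d. \<forall>j\<le>r.
      near_mod1 d e x0 ((affine_lift M \<alpha> ^^ (j * n)) x)"
proof (induction d arbitrary: M \<alpha> rule: less_induct)
  case (less d)
  define N where "N = M - 1\<^sub>m d"
  have M: "M \<in> carrier_mat d d" and \<alpha>: "\<alpha> \<in> carrier_vec d" and \<alpha>_torus: "\<alpha> \<in> torus d"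
    and Ns: "N ^\<^sub>m s = 0\<^sub>m d d"
    using less.prems(1) by (auto simp: affine_system_def N_def torus_carrier)
  have N: "N \<in> carrier_mat d d" unfolding N_def by (intro minus_carrier_mat) simp
  have Nk: "N ^\<^sub>m k \<in> carrier_mat d d" for k using N by simp
  have MN: "M = N + 1\<^sub>m d" using M by (intro eq_matI) (auto simp: N_def)
  show ?case
  proof (cases "N ^\<^sub>m (s - 1) = 0\<^sub>m d d")
    case True
    then have "affine_system (s - 1) d M \<alpha>"
      using M \<alpha>_torus by (simp add: affine_system_def N_def)
    then have "\<forall>U. U \<noteq> {} \<and> torus_open d U \<longrightarrow>
        (\<exists>n\<in>R. \<exists>x\<in>U. \<forall>j\<in>{1..r}. (affine_map d M \<alpha> ^^ (j * n)) x \<in> U)"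
      using rec less.prems(2) unfolding recurrence_set_affine_def by blast
    then show ?thesis by (simp only: recurrence_iff_lift[OF M \<alpha>])
  next
    case False
    then obtain i j where ij: "i < d" "j < d" "(N ^\<^sub>m (s - 1)) $$ (i, j) \<noteq> 0"
      using Nk[of "s - 1"] by (metis (no_types, lifting) carrier_matD eq_matI index_zero_mat)
    \<comment> \<open>A nonzero column of \<open>N^(s-1)\<close>, that is, the image of the
      \<open>j\<close>-th standard basis vector.\<close>
    define B where "B = mat d 1 (\<lambda>(a, _). (N ^\<^sub>m (s - 1)) $$ (a, j))"
    have B: "B \<in> carrier_mat d 1" by (simp add: B_def)
    have "B $$ (i, 0) \<noteq> 0\<^sub>m d 1 $$ (i, 0)" using ij by (simp add: B_def)
    then have B0: "B \<noteq> 0\<^sub>m d 1" by metis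
    define m where "m = d - 1"
    have "m < d" using ij by (simp add: m_def)
    obtain Q S E P g where Q: "Q \<in> carrier_mat m d" and S: "S \<in> carrier_mat d m"
      and E: "E \<in> carrier_mat d 1" and P: "P \<in> carrier_mat 1 d" and QS: "Q * S = 1\<^sub>m m"
      and SQEP: "S * Q + E * P = 1\<^sub>m d" and BE: "B = g \<cdot>\<^sub>m E"
      using integer_column_splitting[OF B B0] unfolding m_def by blast
    have g: "g \<noteq> 0" using B0 BE E by auto
    have "N * B = 0\<^sub>m d 1"
    proof (rule eq_matI)
      fix a c assume "a < dim_row (0\<^sub>m d 1 :: int mat)" "c < dim_col (0\<^sub>m d 1 :: int mat)"
      then have a: "a < d" "c = 0" by auto
      have "col B 0 = col (N ^\<^sub>m (s - 1)) j"
        using N Nk[of "s - 1"] ij by (intro eq_vecI) (auto simp: B_def)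
      then have "(N * B) $$ (a, c) = (N * N ^\<^sub>m (s - 1)) $$ (a, j)"
        using a ij N B Nk[of "s - 1"] by simp
      also have "\<dots> = 0"
        using pow_mat_left_commute[OF N, of "s - 1"] s Ns a ij by simp
      finally show "(N * B) $$ (a, c) = 0\<^sub>m d 1 $$ (a, c)" using a by simp
    qed (use N B in auto)
    then have gNE: "g \<cdot>\<^sub>m (N * E) = 0\<^sub>m d 1"
      using mult_smult_distrib[OF N E, of g] BE by simp
    have NE: "N * E = 0\<^sub>m d 1"
    proof (rule eq_matI)
      fix a c assume ac: "a < dim_row (0\<^sub>m d 1 :: int mat)" "c < dim_col (0\<^sub>m d 1 :: int mat)"
      have "(g \<cdot>\<^sub>m (N * E)) $$ (a, c) = 0" using ac by (simp add: gNE)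
      then show "(N * E) $$ (a, c) = 0\<^sub>m d 1 $$ (a, c)"
        using ac g N E by (auto simp del: index_mult_mat(1))
    qed (use N E in auto)
    have QN: "Q * N \<in> carrier_mat m d" using Q N by (rule mult_carrier_mat)
    \<comment> \<open>The map induced by \<open>N\<close> on the quotient along \<open>E\<close>:
      since \<open>N\<close> kills \<open>E\<close>, \<open>N = N * (S * Q)\<close> and thus
      \<open>Q * N = N' * Q\<close>.\<close>
    define N' where "N' = Q * N * S"
    have N': "N' \<in> carrier_mat m m" unfolding N'_def using QN S by (rule mult_carrier_mat)
    have SQ: "S * Q \<in> carrier_mat d d" and EP: "E * P \<in> carrier_mat d d"
      using mult_carrier_mat[OF S Q] mult_carrier_mat[OF E P] by auto
    have "N * (E * P) = 0\<^sub>m d d"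
      using assoc_mult_mat[OF N E P] NE left_mult_zero_mat[OF P] by simp
    then have N_SQ: "N = N * (S * Q)"
      using mult_add_distrib_mat[OF N SQ EP] SQEP N mult_carrier_mat[OF N SQ] by simp
    then have "Q * N = Q * (N * S * Q)" using assoc_mult_mat[OF N S Q] by simp
    also have "\<dots> = N' * Q"
      unfolding N'_def using assoc_mult_mat[OF Q mult_carrier_mat[OF N S] Q] assoc_mult_mat[OF Q N S] by simp
    finally have QN_eq: "Q * N = N' * Q" .
    have QNk: "Q * N ^\<^sub>m k = N' ^\<^sub>m k * Q" for k
    proof (induction k)
      case 0
      then show ?case using Q N N' by simp
    next
      case (Suc k)
      have N'k: "N' ^\<^sub>m k \<in> carrier_mat m m" using N' by simp
      have "Q * N ^\<^sub>m Suc k = N' ^\<^sub>m k * Q * N"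
        using assoc_mult_mat[OF Q Nk N, of k] Suc by simp
      also have "\<dots> = N' ^\<^sub>m k * N' * Q"
        using assoc_mult_mat[OF N'k Q N] assoc_mult_mat[OF N'k N' Q] QN_eq by simp
      finally show ?case by simp
    qed
    have N's: "N' ^\<^sub>m s = 0\<^sub>m m m"
    proof -
      have c: "N' ^\<^sub>m s \<in> carrier_mat m m" using N' by simp
      have "N' ^\<^sub>m s = (N' ^\<^sub>m s * Q) * S"
        using assoc_mult_mat[OF c Q S] right_mult_one_mat[OF c] by (simp add: QS)
      also have "\<dots> = 0\<^sub>m m m"
        using QNk[of s] right_mult_zero_mat[OF Q] left_mult_zero_mat[OF S] by (simp add: Ns flip: QNk)
      finally show ?thesis .
    qed
    define M' where "M' = N' + 1\<^sub>m m"
    have M': "M' \<in> carrier_mat m m" using N' by (simp add: M'_def)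
    have M'N': "M' - 1\<^sub>m m = N'" using N' by (intro eq_matI) (auto simp: M'_def)
    have QM: "Q * M = M' * Q"
      unfolding MN M'_def using mult_add_distrib_mat[OF Q N, of "1\<^sub>m d"]
        add_mult_distrib_mat[OF N', of "1\<^sub>m m" Q] Q QN_eq by simp
    interpret integer_factor m d M M' Q S \<alpha>
      using M \<alpha> M' Q S QS QM by unfold_locales
    have min: "torus_minimal m (affine_map m M' \<beta>)"
      by (rule torus_minimal_factor) (rule less.prems(2))
    have \<beta>_eq: "affine_map m M' (reduce_mod1 m \<beta>) = affine_map m M' \<beta>"
      by (rule affine_map_reduce_translation[OF M' \<beta>])
    have "affine_system s m M' (reduce_mod1 m \<beta>)"
      using M' N's by (simp add: affine_system_def M'N')
    then have "\<forall>x0\<in>carrier_vec m. \<forall>e>0. \<exists>n\<in>R. \<exists>x\<in>carrier_vec m. \<forall>j\<le>r.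
      near_mod1 m e x0 ((affine_lift M' (reduce_mod1 m \<beta>) ^^ (j * n)) x)"
      using min by (intro less.IH[OF \<open>m < d\<close>]) (simp_all only: \<beta>_eq)
    then have rec': "\<forall>x0\<in>carrier_vec m. \<forall>e>0. \<exists>n\<in>R. \<exists>x\<in>carrier_vec m. \<forall>j\<le>r.
      near_mod1 m e x0 ((affine_lift M' \<beta> ^^ (j * n)) x)"
      by (simp only: recurrence_iff_lift[OF M' \<beta>, symmetric]
          recurrence_iff_lift[OF M' reduce_mod1_carrier, symmetric] \<beta>_eq)
    \<comment> \<open>The quotient must carry a nontrivial character. If it were a point,
      \<open>N = N * (S * Q)\<close> would vanish, and with it \<open>N^(s-1)\<close>, as
      \<open>s \<ge> 2\<close>.\<close>
    have "m > 0"
    proof (rule ccontr)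
      assume "\<not> m > 0"
      then have "S * Q = 0\<^sub>m d d"
        using S Q by (intro eq_matI) (auto simp: scalar_prod_def)
      then have "N = 0\<^sub>m d d"
        using N_SQ right_mult_zero_mat[OF N] by simp
      then show False using pow_mat_eq_zero_mono[of N d 1 "s - 1"] N s False by simp
    qed
    \<comment> \<open>The Jordan chain of the \<open>j\<close>-th standard basis vector; its term of
      index \<open>s - 1\<close> is the column \<open>B\<close>, that is, \<open>g\<close> times
      \<open>E\<close>.\<close>
    define u where "u k = vec d (\<lambda>a. real_of_int ((N ^\<^sub>m k) $$ (a, j)))" for k
    have u: "u k \<in> carrier_vec d" for k by (simp add: u_def)
    have Mu: "rmat M *\<^sub>v u k = u k + u (Suc k)" for k
    proof (rule eq_vecI)
      fix a assume "a < dim_vec (u k + u (Suc k))"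
      then have a: "a < d" by (simp add: u_def)
      have "(rmat M *\<^sub>v u k) $ a = of_int (\<Sum>b<d. M $$ (a, b) * (N ^\<^sub>m k) $$ (b, j))"
        unfolding index_rmat_mult_vec[OF M u a] by (simp add: u_def)
      also have "(\<Sum>b<d. M $$ (a, b) * (N ^\<^sub>m k) $$ (b, j)) = (M * N ^\<^sub>m k) $$ (a, j)"
        using a ij M N by (auto simp: scalar_prod_def lessThan_atLeast0 intro!: sum.cong)
      also have "M * N ^\<^sub>m k = N ^\<^sub>m Suc k + N ^\<^sub>m k"
        unfolding MN using add_mult_distrib_mat[OF N _ Nk, of "1\<^sub>m d" k] pow_mat_left_commute[OF N, of k] left_mult_one_mat[OF Nk, of k]
        by (simp del: pow_mat.simps)
      finally show "(rmat M *\<^sub>v u k) $ a = (u k + u (Suc k)) $ a"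
        using a ij N by (simp add: u_def del: pow_mat.simps)
    qed (use M in \<open>simp add: u_def\<close>)
    have vanish: "u k = 0\<^sub>v d" if "k > s - 1" for k
      using pow_mat_eq_zero_mono[OF N Ns, of k] that ij by (intro eq_vecI) (auto simp: u_def)
    have ut: "u (s - 1) $ a = of_int g * of_int (E $$ (a, 0))" if "a < d" for a
    proof -
      have "(N ^\<^sub>m (s - 1)) $$ (a, j) = B $$ (a, 0)" using that by (simp add: B_def)
      also have "\<dots> = g * E $$ (a, 0)" using that E by (simp add: BE)
      finally show ?thesis using that by (simp add: u_def)
    qed
    show ?thesis
    \<comment> \<open>The return time 0 works trivially with \<open>x = x0\<close>; excluding it
      makes every return time positive.\<close>
    proof (cases "0 \<in> R")
      case True
      then show ?thesis by (intro ballI allI impI bexI[of _ 0]) (auto intro: near_mod1_refl)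
    next
      case R0: False
      show ?thesis
      proof (intro ballI allI impI)
        fix x0 :: "real vec" and e :: real
        assume x0: "x0 \<in> carrier_vec d" and e: "e > 0"
        show "\<exists>n\<in>R. \<exists>x\<in>carrier_vec d. \<forall>j\<le>r. near_mod1 d e x0 ((affine_lift M \<alpha> ^^ (j * n)) x)"
          using affine_lift_recurrence_lifting[OF M \<alpha> \<open>m > 0\<close> M' Q S E P QS SQEP QM
              N's[folded M'N'] min[unfolded \<beta>_def] u Mu vanish ut g r R0 rec'[unfolded \<beta>_def] x0 e] .
      qed
    qed
  qed
qed

theorem mainTheorem14:
  fixes s r :: nat and R :: "nat set"
  assumes "s \<ge> 2" and "1 \<le> r" and "r \<le> s - 1"
    and "recurrence_set_affine r (s - 1) R"
  shows "recurrence_set_affine r s R"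
  unfolding recurrence_set_affine_def
proof (intro allI impI)
  fix d M \<alpha> U
  assume sys: "affine_system s d M \<alpha> \<and> torus_minimal d (affine_map d M \<alpha>)"
    and U: "U \<noteq> {} \<and> torus_open d U"
  have M: "M \<in> carrier_mat d d" and \<alpha>: "\<alpha> \<in> carrier_vec d"
    using sys by (auto simp: affine_system_def torus_carrier)
  have "\<forall>x0\<in>carrier_vec d. \<forall>e>0. \<exists>n\<in>R. \<exists>x\<in>carrier_vec d. \<forall>j\<le>r.
      near_mod1 d e x0 ((affine_lift M \<alpha> ^^ (j * n)) x)"
    using minimal_affine_lift_recurrence[OF assms] sys by blast
  then show "\<exists>n\<in>R. \<exists>x\<in>U. \<forall>j\<in>{1..r}. (affine_map d M \<alpha> ^^ (j * n)) x \<in> U"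
    using U unfolding recurrence_iff_lift[OF M \<alpha>, symmetric] by blast
qed

end
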